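(* For every $n>1$, the odd-dimensional sphere with its standard contact structure $(S^{2n-1},\xi_{\mathrm{std}})$ contains infinitely many (embedded) Legendrian tori $T^{n-1}$ that are pairwise not Legendrian isotopic.
   Context: $\xi_{\mathrm{std}}$ is the field of complex tangencies of the unit sphere $S^{2n-1}\subset\mathbb{C}^n$. A Legendrian torus is a Legendrian submanifold diffeomorphic to $T^{n-1}=(S^1)^{n-1}$. Legendrian isotopic means connected by a smooth family of embedded Legendrian submanifolds. *)

theory Defs
  imports "HOL-Analysis.Analysis"
begin

text \<open>Functions of class \<open>C\<^sup>k\<close> and \<open>C\<^sup>\<infinity>\<close>; meaningful for open domains \<open>U\<close> only.\<close>

primrec Ck_on :: "nat \<Rightarrow> 'a::euclidean_space set \<Rightarrow> ('a \<Rightarrow> 'b::euclidean_space) \<Rightarrow> bool" where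
  "Ck_on 0 U f \<longleftrightarrow> continuous_on U f"
| "Ck_on (Suc k) U f \<longleftrightarrow>
     (\<forall>x\<in>U. f differentiable (at x)) \<and>
     (\<forall>v. Ck_on k U (\<lambda>x. frechet_derivative f (at x) v))"

definition Cinf_on :: "'a::euclidean_space set \<Rightarrow> ('a \<Rightarrow> 'b::euclidean_space) \<Rightarrow> bool" where
  "Cinf_on U f \<longleftrightarrow> (\<forall>k. Ck_on k U f)"

text \<open>Smoothness on an arbitrary subset of a Euclidean space: locally, the map is the restriction
  of a \<open>C\<^sup>\<infinity>\<close> map defined on an open set of the ambient space.  On submanifolds (and their products
  with a closed interval) this agrees with smoothness in charts.\<close>

definition smooth_map :: "'a::euclidean_space set \<Rightarrow> ('a \<Rightarrow> 'b::euclidean_space) \<Rightarrow> bool" where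
  "smooth_map X f \<longleftrightarrow>
     (\<forall>x\<in>X. \<exists>U g. open U \<and> x \<in> U \<and> Cinf_on U g \<and> (\<forall>y\<in>U \<inter> X. g y = f y))"

definition diffeomorphism ::
    "'a::euclidean_space set \<Rightarrow> 'b::euclidean_space set \<Rightarrow> ('a \<Rightarrow> 'b) \<Rightarrow> ('b \<Rightarrow> 'a) \<Rightarrow> bool" where
  "diffeomorphism X Y f g \<longleftrightarrow>
     smooth_map X f \<and> smooth_map Y g \<and> f ` X = Y \<and> g ` Y = X \<and>
     (\<forall>x\<in>X. g (f x) = x) \<and> (\<forall>y\<in>Y. f (g y) = y)"

definition diffeomorphic :: "'a::euclidean_space set \<Rightarrow> 'b::euclidean_space set \<Rightarrow> bool" where
  "diffeomorphic X Y \<longleftrightarrow> (\<exists>f g. diffeomorphism X Y f g)"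

text \<open>Embedded \<open>k\<close>-dimensional submanifolds of a Euclidean space, by slice charts: \<open>P\<close> is a
  \<open>k\<close>-dimensional linear subspace of the ambient space.\<close>

definition embedded_submanifold :: "nat \<Rightarrow> 'a::euclidean_space set \<Rightarrow> bool" where
  "embedded_submanifold k M \<longleftrightarrow>
     (\<forall>p\<in>M. \<exists>U V (\<phi> :: 'a \<Rightarrow> 'a) \<psi> P. open U \<and> p \<in> U \<and> open V \<and> diffeomorphism U V \<phi> \<psi> \<and>
        subspace P \<and> dim P = k \<and> \<phi> ` (U \<inter> M) = V \<inter> P)"

text \<open>The tangent space at \<open>p\<close>, as the set of velocities of smooth curves in \<open>M\<close> through \<open>p\<close>.\<close>

definition tangent_space :: "'a::euclidean_space set \<Rightarrow> 'a \<Rightarrow> 'a set" where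
  "tangent_space M p =
     {v. \<exists>\<epsilon>>0. \<exists>\<gamma>::real \<Rightarrow> 'a. Cinf_on {-\<epsilon><..<\<epsilon>} \<gamma> \<and> \<gamma> ` {-\<epsilon><..<\<epsilon>} \<subseteq> M \<and>
        \<gamma> 0 = p \<and> (\<gamma> has_vector_derivative v) (at 0)}"

definition xi_std :: "complex ^ 'n \<Rightarrow> (complex ^ 'n) set" where
  "xi_std p = tangent_space (sphere 0 1) p \<inter> (\<lambda>v. \<i> *s v) ` tangent_space (sphere 0 1) p"

text \<open>The contact hyperplanes have real dimension \<open>2n-2\<close>, so Legendrian submanifolds, the integral
  submanifolds of maximal dimension, have dimension \<open>n-1\<close>.  A submanifold of \<open>\<complex>\<^sup>n\<close> contained in the
  sphere is the same as a submanifold of the sphere.\<close>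

definition legendrian :: "(complex ^ 'n) set \<Rightarrow> bool" where
  "legendrian L \<longleftrightarrow>
     L \<subseteq> sphere 0 1 \<and> embedded_submanifold (CARD('n) - 1) L \<and>
     (\<forall>p\<in>L. tangent_space L p \<subseteq> xi_std p)"

text \<open>A smooth family \<open>F\<^sub>t\<close>, \<open>0 \<le> t \<le> 1\<close>, of embeddings of \<open>L\<close> starting at the inclusion, all of whose
  images are Legendrian; the last image is \<open>L'\<close>.\<close>

definition legendrian_isotopic :: "(complex ^ 'n) set \<Rightarrow> (complex ^ 'n) set \<Rightarrow> bool" where
  "legendrian_isotopic L L' \<longleftrightarrow>
     (\<exists>F::(complex ^ 'n) \<times> real \<Rightarrow> complex ^ 'n.
        smooth_map (L \<times> {0..1}) F \<and>
        (\<forall>t\<in>{0..1}. legendrian ((\<lambda>x. F (x, t)) ` L) \<and>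
           (\<exists>g. diffeomorphism L ((\<lambda>x. F (x, t)) ` L) (\<lambda>x. F (x, t)) g)) \<and>
        (\<forall>x\<in>L. F (x, 0) = x) \<and>
        (\<lambda>x. F (x, 1)) ` L = L')"

text \<open>The torus \<open>(S\<^sup>1)\<^sup>m\<close>, where \<open>m = CARD('m)\<close>.\<close>

definition torus :: "(complex ^ 'm) set" where
  "torus = {z. \<forall>i. z $ i \<in> sphere 0 1}"

end

theory Submission
  imports Defs "HOL-Complex_Analysis.Cauchy_Integral_Formula"
begin

text \<open>For positive integer weights \<open>w\<close>, the orbit
  \<open>{z. |z\<^sub>j|\<^sup>2 = w\<^sub>j / \<Sum>w, \<Prod>z\<^sub>j^w\<^sub>j > 0}\<close> of a subtorus of the diagonal torus of \<open>U(n)\<close> is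
  Legendrian.  The line through a point of a Legendrian submanifold of the sphere and the tangent
  space there span a Lagrangian subspace of \<open>\<complex>\<^sup>n\<close>, so the complex determinant of a tangent frame
  together with the point never vanishes; its winding number along a loop (the Maslov class, up to
  a factor of 2) is invariant under Legendrian isotopy.  On a weight torus the determinant is
  \<open>\<Prod>z\<^sub>j\<close> up to a real factor and a constant.  For the weights \<open>(1, \<dots>, 1, a + 1)\<close> the possible
  winding numbers are exactly the multiples of \<open>a\<close>, so an isotopy from \<open>a\<close> to \<open>b\<close> forces \<open>b\<close> to
  divide \<open>a\<close>, and distinct primes give tori that are not isotopic.\<close>

section \<open>Calculus of smooth maps\<close>

text \<open>An isotopy supplies only tangency and smooth inverses. Isotropy of the tangent spaces
  and injectivity of differentials have to be extracted from these, by symmetry of second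
  derivatives and by the chain rule. Charts on the tori are avoided by parametrizing over the real
  space indexed by \<open>'n\<close>, one dimension more than the torus has: one coordinate
  \<open>k\<close> is a dummy, and its row in the Jacobian is free for the point itself, which makes
  the frame a square matrix. The multiples of \<open>a\<close> arise as follows: on the torus of
  weights (1, ..., 1, a + 1), with the large weight at \<open>i\<close>, the number (prod z_j) *
  z_i^a is a positive constant, so the phase of prod z_j moves -a times as fast as that of z_i. At
  the start of the isotopy a loop turning z_i once is chosen explicitly. At the end its image lies
  in the other torus under an unknown identification and turns z_i some unknown number N of times.
  Hence a = b * N, and divisibility is all that this comparison yields. The real factor of the
  determinant is known only pointwise, with no control of its sign; phases are therefore compared
  after doubling.\<close>

lemma Ck_on_cong:
  assumes "open U" "\<And>x. x \<in> U \<Longrightarrow> f x = g x" "Ck_on k U f"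
  shows "Ck_on k U g"
  using assms(2,3)
proof (induction k arbitrary: f g)
  case 0
  then show ?case by (metis Ck_on.simps(1) continuous_on_cong)
next
  case (Suc k)
  have eq: "frechet_derivative f (at x) = frechet_derivative g (at x)"
    and dg: "g differentiable (at x)" if "x \<in> U" for x
  proof -
    have d: "f differentiable (at x)" using Suc.prems(2) that by simp
    show "frechet_derivative f (at x) = frechet_derivative g (at x)"
      using frechet_derivative_transform_within_open[OF d assms(1) that] Suc.prems(1) by blast
    show "g differentiable (at x)"
      using d differentiable_def has_derivative_transform_within_open[OF _ assms(1) that] Suc.prems(1)
      by metis
  qed
  have "Ck_on k U (\<lambda>x. frechet_derivative g (at x) v)" for v
    by (rule Suc.IH[where f="\<lambda>x. frechet_derivative f (at x) v"]) (use eq Suc.prems in auto)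
  then show ?case using dg by simp
qed

text \<open>\<open>Ck_on\<close> is phrased with \<open>frechet_derivative\<close>; this rule
  accepts any explicit derivative formula instead, and the closure properties below follow from it
  by induction on \<open>k\<close>.\<close>

lemma Ck_on_SucI:
  assumes "open U" "\<And>x. x \<in> U \<Longrightarrow> (f has_derivative f' x) (at x)"
    and "\<And>v. Ck_on k U (\<lambda>x. f' x v)"
  shows "Ck_on (Suc k) U f"
proof -
  have "Ck_on k U (\<lambda>x. frechet_derivative f (at x) v)" for v
    by (rule Ck_on_cong[OF assms(1) _ assms(3)[of v]])
      (metis assms(2) frechet_derivative_at)
  then show ?thesis using assms(2) differentiableI by fastforce
qed

lemma Ck_on_Suc_has_derivative:
  assumes "Ck_on (Suc k) U f" "x \<in> U"
  shows "(f has_derivative frechet_derivative f (at x)) (at x)"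
  using assms frechet_derivative_works by auto

lemma Ck_on_SucD:
  "Ck_on (Suc k) U f \<Longrightarrow> Ck_on k U f"
proof (induction k arbitrary: f)
  case 0
  then show ?case
    by (simp add: continuous_at_imp_continuous_on differentiable_imp_continuous_within)
next
  case (Suc k)
  then show ?case by (metis Ck_on.simps(2))
qed

lemma Ck_on_subset:
  "Ck_on k U f \<Longrightarrow> V \<subseteq> U \<Longrightarrow> Ck_on k V f"
proof (induction k arbitrary: f)
  case 0
  then show ?case using continuous_on_subset by auto
next
  case (Suc k)
  then show ?case by (simp add: subset_iff)
qed

lemma Ck_on_local:
  assumes "\<And>x. x \<in> U \<Longrightarrow> \<exists>V. open V \<and> x \<in> V \<and> Ck_on k V f"
  shows "Ck_on k U f"
  using assms
proof (induction k arbitrary: f)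
  case 0
  then show ?case
    by (auto intro!: continuous_at_imp_continuous_on) (metis continuous_on_eq_continuous_at)
next
  case (Suc k)
  have "Ck_on k U (\<lambda>x. frechet_derivative f (at x) v)" for v
    by (rule Suc.IH) (metis Suc.prems Ck_on.simps(2))
  moreover have "f differentiable (at x)" if "x \<in> U" for x
    using Suc.prems[OF that] by auto
  ultimately show ?case by simp
qed

lemma Ck_on_const: "open U \<Longrightarrow> Ck_on k U (\<lambda>x. c)"
proof (induction k arbitrary: c)
  case (Suc k)
  show ?case
    by (rule Ck_on_SucI[where f'="\<lambda>x v. 0"]) (use Suc in auto)
qed simp

lemma Ck_on_linear:
  assumes "open U" "bounded_linear f"
  shows "Ck_on k U f"
proof (cases k)
  case 0
  then show ?thesis by (simp add: assms(2) linear_continuous_on)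
next
  case (Suc m)
  have "Ck_on (Suc m) U f"
    by (rule Ck_on_SucI[where f'="\<lambda>x. f"])
      (auto simp: assms bounded_linear_imp_has_derivative intro: Ck_on_const)
  then show ?thesis using Suc by simp
qed

lemma Ck_on_add:
  assumes "open U"
  shows "Ck_on k U f \<Longrightarrow> Ck_on k U g \<Longrightarrow> Ck_on k U (\<lambda>x. f x + g x)"
proof (induction k arbitrary: f g)
  case 0
  then show ?case by (auto intro: continuous_intros)
next
  case (Suc k)
  show ?case
    by (rule Ck_on_SucI[OF assms has_derivative_add[OF
            Ck_on_Suc_has_derivative[OF Suc.prems(1)] Ck_on_Suc_has_derivative[OF Suc.prems(2)]]])
      (use Suc in auto)
qed

lemma Ck_on_sum:
  assumes "open U" "\<And>i. i \<in> I \<Longrightarrow> Ck_on k U (f i)"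
  shows "Ck_on k U (\<lambda>x. \<Sum>i\<in>I. f i x)"
  using assms(2)
  by (induction I rule: infinite_finite_induct) (auto intro: Ck_on_const Ck_on_add assms(1))

lemma Ck_on_bilinear:
  fixes f :: "'a::euclidean_space \<Rightarrow> 'b::euclidean_space" and g :: "'a \<Rightarrow> 'c::euclidean_space"
    and pr :: "'b \<Rightarrow> 'c \<Rightarrow> 'd::euclidean_space"
  assumes "open U" and pr: "bounded_bilinear pr"
  shows "Ck_on k U f \<Longrightarrow> Ck_on k U g \<Longrightarrow> Ck_on k U (\<lambda>x. pr (f x) (g x))"
proof (induction k arbitrary: f g)
  case 0
  then show ?case using bounded_bilinear.continuous_on[OF pr] by auto
next
  case (Suc k)
  show ?case
    by (rule Ck_on_SucI[OF assms(1) bounded_bilinear.FDERIV[OF pr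
            Ck_on_Suc_has_derivative[OF Suc.prems(1)] Ck_on_Suc_has_derivative[OF Suc.prems(2)]]])
      (use Suc in \<open>auto intro!: Ck_on_add assms(1) Suc.IH Ck_on_SucD[of k U f] Ck_on_SucD[of k U g]
          simp del: Ck_on.simps simp: Ck_on.simps(2)\<close>)
qed

lemma Ck_on_compose:
  fixes c :: "'a::euclidean_space \<Rightarrow> 'b::euclidean_space"
    and g :: "'b \<Rightarrow> 'd::euclidean_space"
  assumes "open U" "open V" "c ` U \<subseteq> V"
  shows "Ck_on k V g \<Longrightarrow> Ck_on k U c \<Longrightarrow> Ck_on k U (\<lambda>x. g (c x))"
  using assms(3)
proof (induction k arbitrary: g c)
  case 0
  then show ?case by (metis Ck_on.simps(1) continuous_on_compose2)
next
  case (Suc k)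
  \<comment> \<open>In the chain rule the direction fed to the derivative of \<open>g\<close> moves
    with \<open>x\<close>, whereas \<open>Ck_on\<close> speaks of fixed directions. Expanding it in
    the basis leaves a finite sum of products of functions with fixed directions.\<close>
  let ?f' = "\<lambda>x v. \<Sum>b\<in>Basis. (frechet_derivative c (at x) v \<bullet> b) *\<^sub>R frechet_derivative g (at (c x)) b"
  have "((\<lambda>x. g (c x)) has_derivative ?f' x) (at x)" if "x \<in> U" for x
  proof -
    have g: "(g has_derivative frechet_derivative g (at (c x))) (at (c x))"
      using Ck_on_Suc_has_derivative[OF Suc.prems(1)] Suc.prems(3) that by auto
    have "frechet_derivative g (at (c x)) (frechet_derivative c (at x) v) = ?f' x v" for v
    proof -
      have "frechet_derivative g (at (c x)) (frechet_derivative c (at x) v) =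
        frechet_derivative g (at (c x)) (\<Sum>b\<in>Basis. (frechet_derivative c (at x) v \<bullet> b) *\<^sub>R b)"
        by (simp add: euclidean_representation)
      also have "\<dots> = ?f' x v"
        using has_derivative_linear[OF g] by (simp add: linear_sum linear_scale)
      finally show ?thesis .
    qed
    then have "?f' x = (\<lambda>v. frechet_derivative g (at (c x)) (frechet_derivative c (at x) v))"
      by auto
    then show ?thesis
      using has_derivative_compose[OF Ck_on_Suc_has_derivative[OF Suc.prems(2) that] g] by simp
  qed
  moreover have "Ck_on k U (\<lambda>x. ?f' x v)" for v
  proof (rule Ck_on_sum[OF assms(1)])
    fix b :: 'b assume "b \<in> Basis"
    have 1: "Ck_on k U (\<lambda>x. frechet_derivative c (at x) v \<bullet> b)"
      by (rule Ck_on_bilinear[OF assms(1) bounded_bilinear_inner])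
         (use Suc.prems(2) in \<open>auto intro: Ck_on_const assms(1)\<close>)
    have 2: "Ck_on k U (\<lambda>x. frechet_derivative g (at (c x)) b)"
      by (rule Suc.IH[of "\<lambda>y. frechet_derivative g (at y) b"])
         (use Suc.prems Ck_on_SucD[OF Suc.prems(2)] in auto)
    show "Ck_on k U (\<lambda>x. (frechet_derivative c (at x) v \<bullet> b) *\<^sub>R frechet_derivative g (at (c x)) b)"
      by (rule Ck_on_bilinear[OF assms(1) bounded_bilinear_scaleR 1 2])
  qed
  ultimately show ?case by (rule Ck_on_SucI[OF assms(1)])
qed

lemma Ck_on_holomorphic:
  assumes "open U"
  shows "f holomorphic_on U \<Longrightarrow> Ck_on k U f"
proof (induction k arbitrary: f)
  case 0
  then show ?case by (simp add: holomorphic_on_imp_continuous_on)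
next
  case (Suc k)
  show ?case
  proof (rule Ck_on_SucI[where f'="\<lambda>x v. deriv f x * v", OF assms])
    show "(f has_derivative (*) (deriv f x)) (at x)" if "x \<in> U" for x
      using holomorphic_derivI[OF Suc.prems assms that] by (simp add: has_field_derivative_def)
    show "Ck_on k U (\<lambda>x. deriv f x * v)" for v
      by (rule Suc.IH) (intro holomorphic_intros Suc.prems assms)
  qed
qed

section \<open>Closure rules for infinitely differentiable maps\<close>

lemma Cinf_on_const: "open U \<Longrightarrow> Cinf_on U (\<lambda>x. c)"
  and Cinf_on_linear: "open U \<Longrightarrow> bounded_linear f \<Longrightarrow> Cinf_on U f"
  and Cinf_on_add: "open U \<Longrightarrow> Cinf_on U f \<Longrightarrow> Cinf_on U g \<Longrightarrow> Cinf_on U (\<lambda>x. f x + g x)"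
  and Cinf_on_subset: "Cinf_on U f \<Longrightarrow> V \<subseteq> U \<Longrightarrow> Cinf_on V f"
  by (auto simp: Cinf_on_def intro: Ck_on_const Ck_on_linear Ck_on_add Ck_on_subset)

lemma Cinf_on_sum:
  "open U \<Longrightarrow> (\<And>i. i \<in> I \<Longrightarrow> Cinf_on U (f i)) \<Longrightarrow> Cinf_on U (\<lambda>x. \<Sum>i\<in>I. f i x)"
  by (auto simp: Cinf_on_def intro: Ck_on_sum)

lemma Cinf_on_compose:
  "open U \<Longrightarrow> open V \<Longrightarrow> c ` U \<subseteq> V \<Longrightarrow> Cinf_on V g \<Longrightarrow> Cinf_on U c \<Longrightarrow> Cinf_on U (\<lambda>x. g (c x))"
  unfolding Cinf_on_def using Ck_on_compose by blast

lemma Cinf_on_holomorphic: "open U \<Longrightarrow> f holomorphic_on U \<Longrightarrow> Cinf_on U f"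
  by (simp add: Cinf_on_def Ck_on_holomorphic)

lemma Cinf_on_bounded_linear:
  "bounded_linear f \<Longrightarrow> open U \<Longrightarrow> Cinf_on U g \<Longrightarrow> Cinf_on U (\<lambda>x. f (g x))"
  by (rule Cinf_on_compose[of U UNIV]) (auto intro: Cinf_on_linear)

lemma Cinf_on_mult:
  fixes f g :: "'a::euclidean_space \<Rightarrow> complex"
  shows "open U \<Longrightarrow> Cinf_on U f \<Longrightarrow> Cinf_on U g \<Longrightarrow> Cinf_on U (\<lambda>x. f x * g x)"
  by (simp add: Cinf_on_def Ck_on_bilinear[OF _ bounded_bilinear_mult])

lemma Cinf_on_prod:
  fixes f :: "'i \<Rightarrow> 'a::euclidean_space \<Rightarrow> complex"
  assumes "open U" "\<And>i. i \<in> I \<Longrightarrow> Cinf_on U (f i)"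
  shows "Cinf_on U (\<lambda>x. \<Prod>i\<in>I. f i x)"
  using assms(2)
  by (induction I rule: infinite_finite_induct) (auto intro: Cinf_on_const Cinf_on_mult assms(1))

lemma Cinf_on_power:
  fixes f :: "'a::euclidean_space \<Rightarrow> complex"
  shows "open U \<Longrightarrow> Cinf_on U f \<Longrightarrow> Cinf_on U (\<lambda>x. f x ^ k)"
  by (induction k) (auto intro: Cinf_on_const Cinf_on_mult)

lemma Cinf_on_exp:
  fixes f :: "'a::euclidean_space \<Rightarrow> complex"
  shows "open U \<Longrightarrow> Cinf_on U f \<Longrightarrow> Cinf_on U (\<lambda>x. exp (f x))"
  by (rule Cinf_on_compose[of U UNIV]) (auto intro: Cinf_on_holomorphic holomorphic_intros)

lemma Cinf_on_vec:
  fixes f :: "'a::euclidean_space \<Rightarrow> complex ^ 'n"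
  assumes "open U" "\<And>j. Cinf_on U (\<lambda>x. f x $ j)"
  shows "Cinf_on U f"
proof -
  have "f x = (\<Sum>j\<in>UNIV. axis j (f x $ j))" for x
    by (simp add: vec_eq_iff axis_def)
  moreover have "Cinf_on U (\<lambda>x. \<Sum>j\<in>UNIV. (axis j (f x $ j) :: complex ^ 'n))"
  proof (intro Cinf_on_sum assms(1))
    fix j :: 'n
    have "bounded_linear (axis j :: complex \<Rightarrow> complex ^ 'n)"
      by (intro linear_conv_bounded_linear[THEN iffD1] linearI)
        (auto simp: vec_eq_iff axis_def)
    then show "Cinf_on U (\<lambda>x. axis j (f x $ j) :: complex ^ 'n)"
      using Cinf_on_bounded_linear assms by blast
  qed
  ultimately show ?thesis by simp
qed

lemma Cinf_on_Pair:
  fixes f :: "'a::euclidean_space \<Rightarrow> 'b::euclidean_space" and g :: "'a \<Rightarrow> 'c::euclidean_space"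
  assumes "open U" "Cinf_on U f" "Cinf_on U g"
  shows "Cinf_on U (\<lambda>x. (f x, g x))"
proof -
  have "Cinf_on U (\<lambda>x. (f x, 0) + (0, g x))"
    by (intro Cinf_on_add assms Cinf_on_bounded_linear[where f="\<lambda>y. (y, 0)"]
        Cinf_on_bounded_linear[where f="\<lambda>y. (0, y)"] bounded_linear_intros)
  then show ?thesis by simp
qed

lemma Cinf_on_has_derivative:
  "Cinf_on U f \<Longrightarrow> x \<in> U \<Longrightarrow> (f has_derivative frechet_derivative f (at x)) (at x)"
  unfolding Cinf_on_def using Ck_on_Suc_has_derivative by blast

lemma Cinf_on_frechet_derivative:
  "Cinf_on U f \<Longrightarrow> Cinf_on U (\<lambda>x. frechet_derivative f (at x) v)"
  unfolding Cinf_on_def using Ck_on.simps(2) by blast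

lemma Cinf_on_imp_continuous_on: "Cinf_on U f \<Longrightarrow> continuous_on U f"
  unfolding Cinf_on_def using Ck_on.simps(1) by blast

lemma Cinf_on_imp_smooth_map: "open U \<Longrightarrow> Cinf_on U f \<Longrightarrow> X \<subseteq> U \<Longrightarrow> smooth_map X f"
  unfolding smooth_map_def by blast

section \<open>Smooth maps on arbitrary subsets\<close>

lemma smooth_map_compose:
  fixes g :: "'b::euclidean_space \<Rightarrow> 'c::euclidean_space"
  assumes "open U" "Cinf_on U c" "X \<subseteq> U" "c ` X \<subseteq> Y" "smooth_map Y g"
  shows "smooth_map X (\<lambda>x. g (c x))"
  unfolding smooth_map_def
proof
  fix x assume x: "x \<in> X"
  then obtain V g' where V: "open V" "c x \<in> V" "Cinf_on V g'" "\<forall>y\<in>V \<inter> Y. g' y = g y"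
    using assms(4,5) unfolding smooth_map_def by blast
  let ?W = "U \<inter> c -` V"
  have W: "open ?W"
    using continuous_open_preimage[OF Cinf_on_imp_continuous_on[OF assms(2)] assms(1) V(1)] .
  have "Cinf_on ?W (\<lambda>x. g' (c x))"
    by (rule Cinf_on_compose[OF W V(1) _ V(3) Cinf_on_subset[OF assms(2)]]) auto
  then show "\<exists>U h. open U \<and> x \<in> U \<and> Cinf_on U h \<and> (\<forall>y\<in>U \<inter> X. h y = g (c y))"
    using W V x assms(3,4) by (intro exI[of _ ?W] exI[of _ "\<lambda>x. g' (c x)"]) auto
qed

lemma smooth_map_UNIV:
  assumes "smooth_map UNIV f"
  shows "Cinf_on UNIV f"
  unfolding Cinf_on_def
proof
  fix k
  show "Ck_on k UNIV f"
  proof (rule Ck_on_local)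
    fix x :: 'a
    obtain U g where "open U" "x \<in> U" "Cinf_on U g" "\<forall>y\<in>U. g y = f y"
      using assms unfolding smooth_map_def by (metis Int_UNIV_right UNIV_I)
    then show "\<exists>V. open V \<and> x \<in> V \<and> Ck_on k V f"
      by (metis Ck_on_cong Cinf_on_def)
  qed
qed

text \<open>The second difference \<open>?\<Delta> v w h\<close> is symmetric in \<open>v\<close>
  and \<open>w\<close>. Two applications of the mean value theorem turn its quotient by h^2 into an
  iterated derivative at a point close to \<open>x\<close>, and continuity of that derivative gives
  the limit.\<close>

lemma symmetric_second_derivative_real:
  fixes u :: "'a::euclidean_space \<Rightarrow> real"
  assumes "Ck_on 2 UNIV u"
  shows "frechet_derivative (\<lambda>y. frechet_derivative u (at y) v) (at x) w =
         frechet_derivative (\<lambda>y. frechet_derivative u (at y) w) (at x) v"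
proof -
  let ?D = "\<lambda>v y. frechet_derivative u (at y) v"
  let ?DD = "\<lambda>v w y. frechet_derivative (?D v) (at y) w"
  let ?\<Delta> = "\<lambda>v w h. u (x + h *\<^sub>R v + h *\<^sub>R w) - u (x + h *\<^sub>R v) - u (x + h *\<^sub>R w) + u x"
  have C2: "Ck_on (Suc (Suc 0)) UNIV u"
    using assms by (simp add: numeral_2_eq_2)
  have lim: "((\<lambda>h. ?\<Delta> v w h / h\<^sup>2) \<longlongrightarrow> ?DD v w x) (at_right 0)" for v w
  proof -
    have d1: "((\<lambda>r. u (y + r *\<^sub>R v)) has_real_derivative ?D v (y + r *\<^sub>R v)) (at r)" for y r v
    proof -
      have "((\<lambda>r. u (y + r *\<^sub>R v)) has_derivative (\<lambda>h. frechet_derivative u (at (y + r *\<^sub>R v)) (h *\<^sub>R v))) (at r)"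
        by (rule has_derivative_compose[OF _ Ck_on_Suc_has_derivative[OF C2]])
          (auto intro!: derivative_eq_intros)
      then show ?thesis
        using has_derivative_linear[OF Ck_on_Suc_has_derivative[OF C2]]
        by (simp add: has_field_derivative_def linear_scale mult_commute_abs)
    qed
    have d2: "((\<lambda>r. ?D v (y + r *\<^sub>R w)) has_real_derivative ?DD v w (y + r *\<^sub>R w)) (at r)" for y r w
    proof -
      have C1: "Ck_on (Suc 0) UNIV (?D v)" using C2 by auto
      have "((\<lambda>r. ?D v (y + r *\<^sub>R w)) has_derivative (\<lambda>h. frechet_derivative (?D v) (at (y + r *\<^sub>R w)) (h *\<^sub>R w))) (at r)"
        by (rule has_derivative_compose[OF _ Ck_on_Suc_has_derivative[OF C1]])
          (auto intro!: derivative_eq_intros)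
      then show ?thesis
        using has_derivative_linear[OF Ck_on_Suc_has_derivative[OF C1]]
        by (simp add: has_field_derivative_def linear_scale mult_commute_abs)
    qed
    have mvt: "\<exists>a b. 0 < a \<and> a < h \<and> 0 < b \<and> b < h \<and>
        ?\<Delta> v w h / h\<^sup>2 =
          ?DD v w (x + a *\<^sub>R v + b *\<^sub>R w)" if h: "0 < h" for h
    proof -
      \<comment> \<open>The difference in direction \<open>w\<close>, as a function of the
        displacement along \<open>v\<close>; its increment from 0 to \<open>h\<close> is the second
        difference.\<close>
      let ?\<phi> = "\<lambda>r. u (x + h *\<^sub>R w + r *\<^sub>R v) - u (x + r *\<^sub>R v)"
      have "(?\<phi> has_real_derivative (?D v (x + h *\<^sub>R w + r *\<^sub>R v) - ?D v (x + r *\<^sub>R v))) (at r)" for r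
        by (intro derivative_intros d1)
      then obtain a where a: "0 < a" "a < h"
        "?\<phi> h - ?\<phi> 0 = (h - 0) * (?D v (x + h *\<^sub>R w + a *\<^sub>R v) - ?D v (x + a *\<^sub>R v))"
        using MVT2[OF h, of ?\<phi> "\<lambda>r. ?D v (x + h *\<^sub>R w + r *\<^sub>R v) - ?D v (x + r *\<^sub>R v)"] by blast
      obtain b where b: "0 < b" "b < h"
        "?D v (x + a *\<^sub>R v + h *\<^sub>R w) - ?D v (x + a *\<^sub>R v + 0 *\<^sub>R w) =
         (h - 0) * ?DD v w (x + a *\<^sub>R v + b *\<^sub>R w)"
        using MVT2[OF h d2[of "x + a *\<^sub>R v" w]] by blast
      have "?\<phi> h - ?\<phi> 0 = h * (h * ?DD v w (x + a *\<^sub>R v + b *\<^sub>R w))"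
        using a b by (simp add: algebra_simps)
      then have "?\<Delta> v w h / h\<^sup>2 =
          ?DD v w (x + a *\<^sub>R v + b *\<^sub>R w)"
        using h by (simp add: algebra_simps power2_eq_square)
      with a b show ?thesis by blast
    qed
    then obtain a b where ab: "\<And>h. 0 < h \<Longrightarrow> 0 < a h \<and> a h < h \<and> 0 < b h \<and> b h < h \<and>
        ?\<Delta> v w h / h\<^sup>2 =
          ?DD v w (x + a h *\<^sub>R v + b h *\<^sub>R w)"
      by metis
    have ev: "\<forall>\<^sub>F h in at_right (0::real). 0 < h"
      by (simp add: eventually_at_right_less)
    have "(a \<longlongrightarrow> 0) (at_right 0)" "(b \<longlongrightarrow> 0) (at_right 0)"
      by (rule tendsto_sandwich[OF _ _ tendsto_const tendsto_ident_at];
          use ab in \<open>auto intro!: eventually_mono[OF ev] less_imp_le\<close>)+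
    then have "((\<lambda>h. x + a h *\<^sub>R v + b h *\<^sub>R w) \<longlongrightarrow> x + 0 *\<^sub>R v + 0 *\<^sub>R w) (at_right 0)"
      by (intro tendsto_intros)
    moreover have "isCont (?DD v w) x"
    proof -
      have "continuous_on UNIV (?DD v w)" using C2 by auto
      then show ?thesis using continuous_on_eq_continuous_at by blast
    qed
    ultimately have "((\<lambda>h. ?DD v w (x + a h *\<^sub>R v + b h *\<^sub>R w)) \<longlongrightarrow> ?DD v w x) (at_right 0)"
      using isCont_tendsto_compose[where g="?DD v w" and l=x] by simp
    then show ?thesis
      by (rule Lim_transform_eventually) (auto intro!: eventually_mono[OF ev] dest: ab)
  qed
  have "?DD v w x = ?DD w v x"
  proof (rule tendsto_unique[OF _ lim[of v w]])
    show "((\<lambda>h. ?\<Delta> v w h / h\<^sup>2) \<longlongrightarrow> ?DD w v x) (at_right 0)"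
      using lim[of w v] by (simp add: algebra_simps)
  qed simp
  then show ?thesis .
qed

lemma frechet_derivative_inner:
  assumes "f differentiable (at x)"
  shows "frechet_derivative (\<lambda>y. f y \<bullet> b) (at x) v = frechet_derivative f (at x) v \<bullet> b"
proof -
  have "((\<lambda>y. f y \<bullet> b) has_derivative (\<lambda>v. frechet_derivative f (at x) v \<bullet> b)) (at x)"
    using assms by (intro has_derivative_inner_left) (simp add: frechet_derivative_works)
  then show ?thesis by (metis frechet_derivative_at)
qed

lemma symmetric_second_derivative:
  fixes f :: "'a::euclidean_space \<Rightarrow> 'b::euclidean_space"
  assumes "Cinf_on UNIV f"
  shows "frechet_derivative (\<lambda>y. frechet_derivative f (at y) v) (at x) w =
         frechet_derivative (\<lambda>y. frechet_derivative f (at y) w) (at x) v"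
proof (rule euclidean_eqI)
  fix b :: 'b assume "b \<in> Basis"
  have df: "f differentiable (at y)" for y
    using Cinf_on_has_derivative[OF assms] differentiableI by blast
  have ddf: "(\<lambda>y. frechet_derivative f (at y) v) differentiable (at y)" for y v
    using Cinf_on_has_derivative[OF Cinf_on_frechet_derivative[OF assms]] differentiableI by blast
  have "Cinf_on UNIV (\<lambda>y. f y \<bullet> b)"
    by (rule Cinf_on_bounded_linear[OF bounded_linear_inner_left]) (auto simp: assms)
  then have "Ck_on 2 UNIV (\<lambda>y. f y \<bullet> b)" by (simp add: Cinf_on_def)
  from symmetric_second_derivative_real[OF this, of v x w]
  show "frechet_derivative (\<lambda>y. frechet_derivative f (at y) v) (at x) w \<bullet> b =
         frechet_derivative (\<lambda>y. frechet_derivative f (at y) w) (at x) v \<bullet> b"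
    by (simp add: frechet_derivative_inner[OF df] frechet_derivative_inner[OF ddf])
qed

section \<open>Continuity of smooth families and of their derivatives\<close>

lemma smooth_map_imp_continuous_on:
  assumes "smooth_map X f"
  shows "continuous_on X f"
  unfolding continuous_on_eq_continuous_within
proof
  fix x assume x: "x \<in> X"
  then obtain U g where U: "open U" "x \<in> U" "Cinf_on U g" "\<forall>y\<in>U \<inter> X. g y = f y"
    using assms unfolding smooth_map_def by blast
  have "continuous (at x within X) g"
    using Cinf_on_imp_continuous_on[OF U(3)] U(1,2)
    by (meson continuous_at_imp_continuous_at_within continuous_on_eq_continuous_at)
  moreover have "\<forall>\<^sub>F y in at x within X. g y = f y"
    unfolding eventually_at_filter
    by (rule eventually_mono[OF eventually_nhds_in_open[OF U(1,2)]]) (use U(4) in auto)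
  ultimately show "continuous (at x within X) f"
    using U x by (auto simp: continuous_within intro: Lim_transform_eventually)
qed

lemma smooth_map_slice:
  fixes H :: "'a::euclidean_space \<times> 'c::euclidean_space \<Rightarrow> 'b::euclidean_space"
  assumes "smooth_map (UNIV \<times> T) H" "t \<in> T"
  shows "Cinf_on UNIV (\<lambda>s. H (s, t))"
proof (rule smooth_map_UNIV)
  have "Cinf_on UNIV (\<lambda>s::'a. (s, t))"
    by (rule Cinf_on_Pair) (auto intro: Cinf_on_const Cinf_on_linear)
  then show "smooth_map UNIV (\<lambda>s. H (s, t))"
    by (rule smooth_map_compose[OF open_UNIV _ _ _ assms(1)]) (use assms(2) in auto)
qed

text \<open>For a closed time interval \<open>T\<close> the product is not open, so \<open>H\<close>
  itself need not have a derivative at its boundary. The derivative of a slice is instead read off a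
  local extension \<open>g\<close> in the direction \<open>(v, 0)\<close>, where it is continuous in
  both variables.\<close>

lemma continuous_on_slice_derivative:
  fixes H :: "'a::euclidean_space \<times> 'c::euclidean_space \<Rightarrow> 'b::euclidean_space"
  assumes "smooth_map (UNIV \<times> T) H"
  shows "continuous_on (UNIV \<times> T) (\<lambda>(s, t). frechet_derivative (\<lambda>s. H (s, t)) (at s) v)"
  unfolding continuous_on_eq_continuous_within
proof
  fix z :: "'a \<times> 'c" assume z: "z \<in> UNIV \<times> T"
  obtain U g where U: "open U" "z \<in> U" "Cinf_on U g" "\<forall>y\<in>U \<inter> UNIV \<times> T. g y = H y"
    using assms z unfolding smooth_map_def by blast
  have eq: "frechet_derivative g (at (s, t)) (v, 0) = frechet_derivative (\<lambda>s. H (s, t)) (at s) v"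
    if st: "(s, t) \<in> U" "t \<in> T" for s t
  proof -
    let ?S = "(\<lambda>s. (s, t)) -` U"
    have S: "open ?S" by (intro open_vimage U continuous_intros)
    have "((\<lambda>s. g (s, t)) has_derivative (\<lambda>v. frechet_derivative g (at (s, t)) (v, 0))) (at s)"
      by (rule has_derivative_compose[where f="\<lambda>s. (s, t)" and f'="\<lambda>v. (v, 0)",
            OF _ Cinf_on_has_derivative[OF U(3) st(1)]])
        (auto intro!: derivative_eq_intros)
    then have "((\<lambda>s. H (s, t)) has_derivative (\<lambda>v. frechet_derivative g (at (s, t)) (v, 0))) (at s)"
      by (rule has_derivative_transform_within_open[OF _ S]) (use U st in auto)
    then show ?thesis by (metis frechet_derivative_at)
  qed
  have "continuous_on U (\<lambda>z. frechet_derivative g (at z) (v, 0))"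
    by (intro Cinf_on_imp_continuous_on Cinf_on_frechet_derivative U)
  then have "continuous (at z within (UNIV \<times> T)) (\<lambda>z. frechet_derivative g (at z) (v, 0))"
    using U continuous_at_imp_continuous_at_within continuous_on_eq_continuous_at by blast
  moreover have "\<forall>\<^sub>F y in at z within (UNIV \<times> T).
      frechet_derivative g (at y) (v, 0) = (case y of (s, t) \<Rightarrow> frechet_derivative (\<lambda>s. H (s, t)) (at s) v)"
    unfolding eventually_at_filter
    by (rule eventually_mono[OF eventually_nhds_in_open[OF U(1,2)]]) (use eq in auto)
  ultimately show "continuous (at z within UNIV \<times> T)
     (\<lambda>(s, t). frechet_derivative (\<lambda>s. H (s, t)) (at s) v)"
    using z eq U(2) by (auto simp: continuous_within tendsto_cong split: prod.splits intro: Lim_transform_eventually)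
qed

section \<open>Tangent spaces and Legendrian frames\<close>

lemma
  fixes v w :: "complex ^ 'n"
  shows inner_i_mult_both: "(\<i> *s v) \<bullet> (\<i> *s w) = v \<bullet> w"
    and inner_i_mult_left: "(\<i> *s v) \<bullet> w = - (v \<bullet> (\<i> *s w))"
  by (simp_all add: inner_vec_def inner_complex_def flip: sum_negf) (simp_all add: algebra_simps)

lemma bounded_linear_i_mult: "bounded_linear (\<lambda>v :: complex ^ 'n. \<i> *s v)"
  by (intro linear_conv_bounded_linear[THEN iffD1] linearI)
    (auto simp: vec_eq_iff algebra_simps)

lemma tangent_spaceE:
  assumes "v \<in> tangent_space M p"
  obtains \<epsilon> \<gamma> where "\<epsilon> > 0" "Cinf_on {-\<epsilon><..<\<epsilon>} \<gamma>" "\<And>s. s \<in> {-\<epsilon><..<\<epsilon>} \<Longrightarrow> \<gamma> s \<in> M"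
    "\<gamma> 0 = p" "(\<gamma> has_vector_derivative v) (at 0)"
  using assms unfolding tangent_space_def by blast

lemma tangent_space_range:
  fixes h :: "'a::euclidean_space \<Rightarrow> 'b::euclidean_space"
  assumes "Cinf_on UNIV h" "range h \<subseteq> M"
  shows "frechet_derivative h (at s) v \<in> tangent_space M (h s)"
proof -
  have "Cinf_on UNIV (\<lambda>r::real. s + r *\<^sub>R v)"
    by (rule Cinf_on_add[OF open_UNIV Cinf_on_const Cinf_on_linear])
      (auto intro: bounded_linear_scaleR_left)
  then have "Cinf_on UNIV (\<lambda>r::real. h (s + r *\<^sub>R v))"
    by (intro Cinf_on_compose[OF _ _ _ assms(1)]) auto
  then have 1: "Cinf_on {-1<..<1} (\<lambda>r::real. h (s + r *\<^sub>R v))"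
    by (rule Cinf_on_subset) auto
  have h: "(h has_derivative frechet_derivative h (at s)) (at s)"
    using Cinf_on_has_derivative[OF assms(1)] by blast
  have "((\<lambda>r::real. h (s + r *\<^sub>R v)) has_derivative (\<lambda>r. frechet_derivative h (at s) (r *\<^sub>R v))) (at 0)"
    by (rule has_derivative_compose[where f="\<lambda>r. s + r *\<^sub>R v" and f'="\<lambda>r. r *\<^sub>R v"])
      (use h in \<open>auto intro!: derivative_eq_intros\<close>)
  then have 2: "((\<lambda>r::real. h (s + r *\<^sub>R v)) has_vector_derivative frechet_derivative h (at s) v) (at 0)"
    using has_derivative_linear[OF h] by (simp add: has_vector_derivative_def linear_scale)
  show ?thesis unfolding tangent_space_def
    using 1 2 assms(2) by (auto intro!: exI[of _ 1] exI[of _ "\<lambda>r::real. h (s + r *\<^sub>R v)"])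
qed

lemma tangent_space_sphere:
  fixes p :: "'a::euclidean_space"
  assumes p: "norm p = 1"
  shows "tangent_space (sphere 0 1) p = {v. p \<bullet> v = 0}"
proof (intro equalityI subsetI CollectI)
  fix v assume "v \<in> tangent_space (sphere 0 1) p"
  then obtain \<epsilon> \<gamma> where \<gamma>: "\<epsilon> > 0" "\<And>s. s \<in> {-\<epsilon><..<\<epsilon>} \<Longrightarrow> \<gamma> s \<in> sphere 0 1"
    "\<gamma> 0 = p" "(\<gamma> has_vector_derivative v) (at 0)"
    by (rule tangent_spaceE) blast
  have "((\<lambda>s. \<gamma> s \<bullet> \<gamma> s) has_derivative (\<lambda>r. \<gamma> 0 \<bullet> (r *\<^sub>R v) + (r *\<^sub>R v) \<bullet> \<gamma> 0)) (at 0)"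
    using \<gamma>(4) unfolding has_vector_derivative_def by (intro has_derivative_inner)
  then have "((\<lambda>s. 1) has_derivative (\<lambda>r. \<gamma> 0 \<bullet> (r *\<^sub>R v) + (r *\<^sub>R v) \<bullet> \<gamma> 0)) (at 0)"
    by (rule has_derivative_transform_within_open[where s="{-\<epsilon><..<\<epsilon>}"])
      (use \<gamma>(1,2) in \<open>auto simp: dot_square_norm\<close>)
  from has_derivative_unique[OF this has_derivative_const]
  have "\<gamma> 0 \<bullet> (1 *\<^sub>R v) + (1 *\<^sub>R v) \<bullet> \<gamma> 0 = 0" by meson
  then show "p \<bullet> v = 0" by (simp add: \<gamma>(3) inner_commute)
next
  fix v assume "v \<in> {v. p \<bullet> v = 0}"
  then have v: "p \<bullet> v = 0" by simp
  \<comment> \<open>The great circle leaving \<open>p\<close> with velocity \<open>v\<close>; for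
    \<open>v = 0\<close> the quotient by zero is 0 and the curve is constant. Its smoothness is
    obtained by reading cosine and sine as real and imaginary parts of a complex
    exponential.\<close>
  define \<gamma> where "\<gamma> = (\<lambda>s. cos (norm v * s) *\<^sub>R p + (sin (norm v * s) / norm v) *\<^sub>R v)"
  have \<gamma>': "\<gamma> s = Re (exp (complex_of_real (norm v * s) * \<i>)) *\<^sub>R p
      + Im (exp (complex_of_real (norm v * s) * \<i>)) *\<^sub>R (v /\<^sub>R norm v)" for s
    by (simp add: \<gamma>_def Re_exp Im_exp divide_inverse)
  have e: "Cinf_on UNIV (\<lambda>s::real. exp (complex_of_real (norm v * s) * \<i>))"
    by (intro Cinf_on_exp Cinf_on_linear bounded_linear_mult_const
        bounded_linear_compose[OF bounded_linear_of_real] bounded_linear_mult_right) auto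
  have "Cinf_on UNIV \<gamma>" unfolding \<gamma>'
    by (intro Cinf_on_add Cinf_on_bounded_linear[OF _ _ e, where f="\<lambda>z. Re z *\<^sub>R _"]
        Cinf_on_bounded_linear[OF _ _ e, where f="\<lambda>z. Im z *\<^sub>R _"]
        bounded_linear_scaleR_const bounded_linear_Re bounded_linear_Im) auto
  then have "Cinf_on {-1<..<1} \<gamma>" by (rule Cinf_on_subset) simp
  moreover have "norm (\<gamma> s) = 1" for s
  proof (cases "v = 0")
    case False
    have "\<gamma> s \<bullet> \<gamma> s = (cos (norm v * s))\<^sup>2 + (sin (norm v * s))\<^sup>2"
    proof -
      have pp: "p \<bullet> p = 1" and vv: "v \<bullet> v = (norm v)\<^sup>2" and vp: "v \<bullet> p = 0"
        using p v by (simp_all add: dot_square_norm inner_commute)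
      show ?thesis
        unfolding \<gamma>_def inner_add_left inner_add_right inner_scaleR_left inner_scaleR_right pp vv vp v
        using False by (simp add: power2_eq_square)
    qed
    then show ?thesis by (simp add: norm_eq_sqrt_inner)
  qed (simp add: \<gamma>_def p)
  moreover have "(\<gamma> has_vector_derivative v) (at 0)"
    unfolding \<gamma>_def by (cases "v = 0") (auto intro!: derivative_eq_intros simp: has_vector_derivative_def)
  moreover have "\<gamma> 0 = p" by (simp add: \<gamma>_def)
  ultimately show "v \<in> tangent_space (sphere 0 1) p"
    unfolding tangent_space_def by (auto intro!: exI[of _ 1] exI[of _ \<gamma>])
qed

text \<open>Tangency to the sphere is orthogonality to \<open>p\<close>, and multiplication by \<i>
  is an isometry, so the two conditions say that \<open>v\<close> is Hermitian orthogonal to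
  \<open>p\<close>.\<close>

lemma xi_std_eq:
  fixes p :: "complex ^ 'n"
  assumes "norm p = 1"
  shows "xi_std p = {v. p \<bullet> v = 0 \<and> (\<i> *s p) \<bullet> v = 0}"
proof -
  have "v \<in> (\<lambda>v. \<i> *s v) ` {v. p \<bullet> v = 0} \<longleftrightarrow> (\<i> *s p) \<bullet> v = 0" for v
  proof
    assume "(\<i> *s p) \<bullet> v = 0"
    moreover have "v = \<i> *s ((- \<i>) *s v)" by (simp add: vec_eq_iff)
    ultimately show "v \<in> (\<lambda>v. \<i> *s v) ` {v. p \<bullet> v = 0}"
      using inner_i_mult_both[of p "(- \<i>) *s v"] by (intro image_eqI[where x="(- \<i>) *s v"]) auto
  qed (auto simp: inner_i_mult_both)
  then show ?thesis unfolding xi_std_def tangent_space_sphere[OF assms] by blast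
qed

text \<open>This is \<open>d\<alpha> = 0\<close> on Legendrian submanifolds, for the contact form \<open>\<alpha>\<^sub>p(v) = (\<i> p) \<bullet> v\<close>.\<close>

lemma isotropic_derivative:
  fixes h :: "'a::euclidean_space \<Rightarrow> complex ^ 'n"
  assumes h: "Cinf_on UNIV h"
    and leg: "\<And>s v. (\<i> *s h s) \<bullet> frechet_derivative h (at s) v = 0"
  shows "(\<i> *s frechet_derivative h (at s) v) \<bullet> frechet_derivative h (at s) w = 0"
proof -
  let ?D = "\<lambda>w s. frechet_derivative h (at s) w"
  have *: "(\<i> *s h s) \<bullet> frechet_derivative (?D w) (at s) v + (\<i> *s ?D v s) \<bullet> ?D w s = 0" for v w
  proof -
    have "((\<lambda>s. (\<i> *s h s) \<bullet> ?D w s) has_derivative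
        (\<lambda>v. (\<i> *s h s) \<bullet> frechet_derivative (?D w) (at s) v + (\<i> *s ?D v s) \<bullet> ?D w s)) (at s)"
      by (intro has_derivative_inner bounded_linear.has_derivative[OF bounded_linear_i_mult]
          Cinf_on_has_derivative[OF h] Cinf_on_has_derivative[OF Cinf_on_frechet_derivative[OF h]]) auto
    then have "((\<lambda>s. 0) has_derivative
        (\<lambda>v. (\<i> *s h s) \<bullet> frechet_derivative (?D w) (at s) v + (\<i> *s ?D v s) \<bullet> ?D w s)) (at s)"
      by (simp add: leg)
    from has_derivative_unique[OF this has_derivative_const] show ?thesis by meson
  qed
  \<comment> \<open>Symmetry of the second derivative makes the form symmetric in \<open>v\<close>
    and \<open>w\<close>; since \<i> acts skew-symmetrically it is also antisymmetric, hence
    zero.\<close>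
  have "(\<i> *s ?D v s) \<bullet> ?D w s = (\<i> *s ?D w s) \<bullet> ?D v s"
    using *[of v w] *[of w v] symmetric_second_derivative[OF h, of v s w] by simp
  then show ?thesis
    using inner_i_mult_left[of "?D v s" "?D w s"] inner_commute[of "?D v s" "\<i> *s ?D w s"] by simp
qed

lemma legendrian_param:
  fixes h :: "'a::euclidean_space \<Rightarrow> complex ^ 'n"
  assumes M: "legendrian M" and h: "Cinf_on UNIV h" "range h \<subseteq> M"
  shows "norm (h s) = 1"
    and "h s \<bullet> frechet_derivative h (at s) v = 0"
    and "(\<i> *s h s) \<bullet> frechet_derivative h (at s) v = 0"
    and "(\<i> *s frechet_derivative h (at s) v) \<bullet> frechet_derivative h (at s) w = 0"
proof -
  have hM: "h s \<in> M" for s using h by auto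
  show nh: "norm (h s) = 1" for s using hM[of s] M unfolding legendrian_def by auto
  have xi: "frechet_derivative h (at s) v \<in> xi_std (h s)" for s v
    using tangent_space_range[OF h] M hM[of s] unfolding legendrian_def by blast
  show "h s \<bullet> frechet_derivative h (at s) v = 0"
    using xi[of s v] by (simp add: xi_std_eq[OF nh])
  have *: "(\<i> *s h s) \<bullet> frechet_derivative h (at s) v = 0" for s v
    using xi[of s v] by (simp add: xi_std_eq[OF nh])
  show "(\<i> *s h s) \<bullet> frechet_derivative h (at s) v = 0" using * .
  show "(\<i> *s frechet_derivative h (at s) v) \<bullet> frechet_derivative h (at s) w = 0"
    by (rule isotropic_derivative[OF h(1) *])
qed

text \<open>Embeddings in an isotopy come with a smooth inverse, not with an injective differential.
  Since \<open>g\<close> undoes \<open>h\<close> up to \<open>\<Phi>\<close>, the chain rule factors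
  the derivative of \<open>\<Phi>\<close> through that of \<open>h\<close>; the derivative of
  \<open>g\<close> is that of a local extension.\<close>

lemma kernel_derivative_left_inverse:
  fixes h :: "'a::euclidean_space \<Rightarrow> 'b::euclidean_space" and g :: "'b \<Rightarrow> 'c::euclidean_space"
  assumes g: "smooth_map M g" and h: "range h \<subseteq> M" "(h has_derivative A) (at s)" "continuous_on UNIV h"
    and "\<And>x. g (h x) = \<Phi> x" and \<Phi>: "(\<Phi> has_derivative B) (at s)" and "A v = 0"
  shows "B v = 0"
proof -
  obtain U g' where U: "open U" "h s \<in> U" "Cinf_on U g'" "\<forall>y\<in>U \<inter> M. g' y = g y"
    using g h(1) unfolding smooth_map_def by (meson rangeI subsetD)
  let ?G = "frechet_derivative g' (at (h s))"
  have G: "(g' has_derivative ?G) (at (h s))" using Cinf_on_has_derivative[OF U(3,2)] .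
  have "((\<lambda>x. g' (h x)) has_derivative (\<lambda>v. ?G (A v))) (at s)"
    by (rule has_derivative_compose[OF h(2) G])
  then have "(\<Phi> has_derivative (\<lambda>v. ?G (A v))) (at s)"
    by (rule has_derivative_transform_within_open[where s="h -` U"])
      (use U h assms(5) in \<open>auto intro: open_vimage simp: image_subset_iff\<close>)
  then have "B = (\<lambda>v. ?G (A v))" using has_derivative_unique[OF \<Phi>] by blast
  then show ?thesis using assms(7) has_derivative_linear[OF G] by (simp add: linear_0)
qed

text \<open>Lagrangian subspaces are totally real, so vectors in one that are independent over the
  reals stay independent over the complex numbers. A complex relation between the rows is split into
  real and imaginary parts, which are eliminated by pairing with suitable vectors.\<close>

lemma det_legendrian_frame:
  fixes A :: "real ^ 'n \<Rightarrow> complex ^ 'n"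
  assumes A: "linear A" and q: "q \<noteq> 0" "\<And>v. q \<bullet> A v = 0" "\<And>v. (\<i> *s q) \<bullet> A v = 0"
    and isotropic: "\<And>v w. (\<i> *s A v) \<bullet> A w = 0"
    and inj: "\<And>v. A v = 0 \<Longrightarrow> v $ k = 0 \<Longrightarrow> v = 0"
  shows "det (\<chi> r. if r = k then q else A (axis r 1)) \<noteq> 0"
proof
  let ?M = "\<chi> r. if r = k then q else A (axis r 1)"
  assume "det ?M = 0"
  then have "\<not> (\<exists>B. ?M ** B = mat 1)"
    using invertible_det_nz[of ?M] invertible_right_inverse[of ?M] by blast
  then obtain c j where c: "(\<Sum>r\<in>UNIV. c r *s row r ?M) = 0" and j: "c j \<noteq> 0"
    unfolding matrix_right_invertible_independent_rows by blast
  \<comment> \<open>Slot \<open>k\<close> is set to zero because row \<open>k\<close> is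
    \<open>q\<close> and not a value of \<open>A\<close>; this also supplies the side condition of
    \<open>inj\<close>.\<close>
  define a b :: "real ^ 'n" where "a = (\<chi> r. if r = k then 0 else Re (c r))"
    and "b = (\<chi> r. if r = k then 0 else Im (c r))"
  let ?J = "\<lambda>v :: complex ^ 'n. \<i> *s v"
  have J: "linear ?J" using bounded_linear_i_mult bounded_linear.linear by blast
  have expand: "A v = (\<Sum>r\<in>UNIV. v $ r *\<^sub>R A (axis r 1))" for v
  proof -
    have "A v = A (\<Sum>r\<in>UNIV. v $ r *s axis r 1)" by (simp add: basis_expansion)
    then show ?thesis by (simp add: linear_sum[OF A] linear_scale[OF A] scalar_mult_eq_scaleR)
  qed
  have "c r *s row r ?M = (if r = k then c k *s q else 0) + (a $ r *\<^sub>R A (axis r 1) + ?J (b $ r *\<^sub>R A (axis r 1)))" for r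
    by (auto simp: vec_eq_iff row_def a_def b_def complex_eq_iff)
  then have "c k *s q + (A a + ?J (A b)) = 0"
    using c by (simp add: sum.distrib expand[of a] expand[of b] linear_sum[OF J])
  moreover have "c k *s q = Re (c k) *\<^sub>R q + Im (c k) *\<^sub>R ?J q"
    by (simp add: vec_eq_iff complex_eq_iff)
  ultimately have eq: "Re (c k) *\<^sub>R q + Im (c k) *\<^sub>R ?J q + A a + ?J (A b) = 0"
    by (simp add: add.assoc)
  have qJ: "q \<bullet> ?J q = 0" "?J q \<bullet> q = 0"
    using inner_i_mult_left[of q q] inner_commute[of q "?J q"] by auto
  have qA: "q \<bullet> ?J (A v) = 0" "?J q \<bullet> ?J (A v) = 0" for v
    using inner_i_mult_left[of q "A v"] inner_i_mult_both[of q "A v"] q by auto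
  \<comment> \<open>Both \<open>q\<close> and \<open>\<i> *s q\<close> are orthogonal to everything
    tangential and to \<i> times it, so the two pairings isolate the real and the imaginary part of
    \<open>c k\<close>.\<close>
  have "q \<bullet> (Re (c k) *\<^sub>R q + Im (c k) *\<^sub>R ?J q + A a + ?J (A b)) = Re (c k) * (q \<bullet> q)"
    by (simp only: inner_add_right inner_scaleR_right qJ qA q)
  then have "Re (c k) = 0" using q eq by simp
  moreover have "?J q \<bullet> (Re (c k) *\<^sub>R q + Im (c k) *\<^sub>R ?J q + A a + ?J (A b)) = Im (c k) * (q \<bullet> q)"
    by (simp only: inner_add_right inner_scaleR_right qJ qA q inner_i_mult_both)
  then have "Im (c k) = 0" using q eq by simp
  ultimately have ck: "c k = 0" by (simp add: complex_eq_iff)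
  have ab: "A a + ?J (A b) = 0" using eq \<open>Re (c k) = 0\<close> \<open>Im (c k) = 0\<close> by simp
  \<comment> \<open>Isotropy removes the term with \<open>A a\<close>, and what is left is the
    squared norm of \<open>A b\<close>.\<close>
  then have "?J (A b) \<bullet> (A a + ?J (A b)) = 0" by simp
  then have "A b = 0" by (simp add: inner_add_right isotropic inner_i_mult_both)
  moreover from this have "A a = 0" using ab by (simp add: linear_0[OF J])
  ultimately have "a = 0" "b = 0" using inj by (simp_all add: a_def b_def)
  then have "c j = 0"
    using ck by (cases "j = k") (auto simp: vec_eq_iff a_def b_def complex_eq_iff dest: spec[of _ j])
  with j show False by simp
qed

text \<open>The matrix is diag(c) * X * diag(q) with \<open>X\<close> real. Tangent frames of weight
  tori have this shape, and the phase of their determinant is thereby that of the coordinate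
  product, up to a constant and a sign.\<close>

lemma det_real_rotated:
  fixes X :: "'n::finite \<Rightarrow> 'n \<Rightarrow> real" and q :: "complex ^ 'n"
  shows "det (\<chi> r l. c r * of_real (X r l) * q $ l) = prod c UNIV * of_real (det (\<chi> r l. X r l)) * (\<Prod>l\<in>UNIV. q $ l)"
proof -
  have "(\<Prod>r\<in>UNIV. c r * of_real (X r (p r)) * q $ p r) =
      prod c UNIV * of_real (\<Prod>r\<in>UNIV. X r (p r)) * (\<Prod>l\<in>UNIV. q $ l)" if "p permutes UNIV" for p
    using prod.permute[OF that, of "\<lambda>l. q $ l"] by (simp add: prod.distrib o_def)
  then show ?thesis
    unfolding det_def by (simp add: sum_distrib_left sum_distrib_right mult_ac)
qed

section \<open>Weight tori\<close>

text \<open>Squared radii proportional to the weights make the linearized product equation coincide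
  with Hermitian orthogonality to the point; dividing by the total weight gives norm 1.\<close>

definition weight_radius :: "('n::finite \<Rightarrow> nat) \<Rightarrow> 'n \<Rightarrow> real" where
  "weight_radius w j = sqrt (real (w j) / real (\<Sum>l\<in>UNIV. w l))"

text \<open>With the moduli prescribed, positivity of the weighted product is the same as equality
  with the product of the radii, for positive weights.\<close>

definition weight_torus :: "('n::finite \<Rightarrow> nat) \<Rightarrow> (complex ^ 'n) set" where
  "weight_torus w = {z. (\<forall>j. cmod (z $ j) = weight_radius w j) \<and>
     (\<Prod>j\<in>UNIV. z $ j ^ w j) = of_real (\<Prod>j\<in>UNIV. weight_radius w j ^ w j)}"

lemma weight_radius_power2: "(weight_radius w j)\<^sup>2 = real (w j) / real (\<Sum>l\<in>UNIV. w l)"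
  by (simp add: weight_radius_def sum_nonneg)

lemma weight_radius_pos:
  fixes w :: "'n::finite \<Rightarrow> nat"
  assumes "\<And>j. w j > 0"
  shows "weight_radius w j > 0"
proof -
  have "(\<Sum>l\<in>UNIV. w l) > 0" using assms by (intro sum_pos) auto
  then show ?thesis unfolding weight_radius_def using assms[of j] by (simp del: of_nat_sum)
qed

lemma weight_torus_component_nonzero:
  "(\<And>j. w j > 0) \<Longrightarrow> z \<in> weight_torus w \<Longrightarrow> z $ j \<noteq> 0"
  unfolding weight_torus_def using weight_radius_pos[of w j] by (auto dest: spec[of _ j])

lemma weight_torus_component_cnj:
  assumes "z \<in> weight_torus w"
  shows "cnj (z $ j) * z $ j = of_real (real (w j) / real (\<Sum>l\<in>UNIV. w l))"
proof -
  have "cnj (z $ j) * z $ j = of_real ((cmod (z $ j))\<^sup>2)"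
    using complex_norm_square[of "z $ j"] by (simp add: mult.commute)
  also have "cmod (z $ j) = weight_radius w j" using assms by (simp add: weight_torus_def)
  finally show ?thesis unfolding weight_radius_power2 .
qed

lemma weight_torus_subset_sphere:
  fixes w :: "'n::finite \<Rightarrow> nat"
  assumes "\<And>j. w j > 0"
  shows "weight_torus w \<subseteq> sphere 0 1"
proof
  fix z assume z: "z \<in> weight_torus w"
  have W: "(\<Sum>l\<in>UNIV. w l) > 0" using assms by (intro sum_pos) auto
  have "(norm z)\<^sup>2 = (\<Sum>j\<in>UNIV. (cmod (z $ j))\<^sup>2)"
    by (simp add: norm_vec_def L2_set_def sum_nonneg)
  also have "\<dots> = (\<Sum>j\<in>UNIV. real (w j) / real (\<Sum>l\<in>UNIV. w l))"
    using z by (simp add: weight_torus_def weight_radius_power2)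
  also have "\<dots> = real (\<Sum>l\<in>UNIV. w l) / real (\<Sum>l\<in>UNIV. w l)"
    by (simp only: of_nat_sum sum_divide_distrib)
  also have "\<dots> = 1" using W by (metis divide_self of_nat_0_eq_iff not_gr_zero)
  finally show "z \<in> sphere 0 1" by (simp add: power2_eq_1_iff) (smt (verit) norm_ge_zero)
qed

text \<open>Both defining equations are constant along a curve in the torus, so their derivatives
  vanish; for the product, dividing by its nonzero value yields the logarithmic derivative.\<close>

lemma tangent_weight_torus:
  fixes w :: "'n::finite \<Rightarrow> nat"
  assumes w: "\<And>j. w j > 0" and v: "v \<in> tangent_space (weight_torus w) p"
  shows "Re (cnj (p $ j) * v $ j) = 0" and "(\<Sum>j\<in>UNIV. of_nat (w j) * (v $ j / p $ j)) = 0"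
    and "p \<in> weight_torus w"
proof -
  obtain \<epsilon> \<gamma> where \<gamma>: "\<epsilon> > 0" "\<And>s. s \<in> {-\<epsilon><..<\<epsilon>} \<Longrightarrow> \<gamma> s \<in> weight_torus w"
    "\<gamma> 0 = p" "(\<gamma> has_vector_derivative v) (at 0)"
    using v by (rule tangent_spaceE) blast
  show p: "p \<in> weight_torus w" using \<gamma>(1-3) by force
  have dj: "((\<lambda>s. \<gamma> s $ j) has_derivative (\<lambda>r. r *\<^sub>R v $ j)) (at 0)" for j
    using bounded_linear.has_derivative[OF bounded_linear_vec_nth \<gamma>(4)[unfolded has_vector_derivative_def], of j]
    by simp
  have "((\<lambda>s. \<gamma> s $ j \<bullet> \<gamma> s $ j) has_derivative (\<lambda>r. \<gamma> 0 $ j \<bullet> (r *\<^sub>R v $ j) + (r *\<^sub>R v $ j) \<bullet> \<gamma> 0 $ j)) (at 0)"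
    by (intro has_derivative_inner dj)
  then have "((\<lambda>s. (weight_radius w j)\<^sup>2) has_derivative (\<lambda>r. \<gamma> 0 $ j \<bullet> (r *\<^sub>R v $ j) + (r *\<^sub>R v $ j) \<bullet> \<gamma> 0 $ j)) (at 0)"
    by (rule has_derivative_transform_within_open[where s="{-\<epsilon><..<\<epsilon>}"])
      (use \<gamma>(1,2) in \<open>auto simp: dot_square_norm weight_torus_def\<close>)
  from has_derivative_unique[OF this has_derivative_const]
  have "\<gamma> 0 $ j \<bullet> (1 *\<^sub>R v $ j) + (1 *\<^sub>R v $ j) \<bullet> \<gamma> 0 $ j = 0" by meson
  then show "Re (cnj (p $ j) * v $ j) = 0"
    by (simp add: \<gamma>(3) inner_complex_def mult.commute)
  let ?P = "\<Prod>j\<in>UNIV. p $ j ^ w j"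
  have nz: "p $ j \<noteq> 0" for j using weight_torus_component_nonzero[OF w p] .
  have "((\<lambda>s. \<Prod>j\<in>UNIV. \<gamma> s $ j ^ w j) has_derivative
      (\<lambda>r. \<Sum>j\<in>UNIV. of_nat (w j) * (r *\<^sub>R v $ j) * \<gamma> 0 $ j ^ (w j - 1) * (\<Prod>l\<in>UNIV - {j}. \<gamma> 0 $ l ^ w l))) (at 0)"
    by (intro has_derivative_prod has_derivative_power dj)
  then have "((\<lambda>s. complex_of_real (\<Prod>j\<in>UNIV. weight_radius w j ^ w j)) has_derivative
      (\<lambda>r. \<Sum>j\<in>UNIV. of_nat (w j) * (r *\<^sub>R v $ j) * \<gamma> 0 $ j ^ (w j - 1) * (\<Prod>l\<in>UNIV - {j}. \<gamma> 0 $ l ^ w l))) (at 0)"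
    by (rule has_derivative_transform_within_open[where s="{-\<epsilon><..<\<epsilon>}"])
      (use \<gamma>(1,2) in \<open>auto simp: weight_torus_def\<close>)
  from has_derivative_unique[OF this has_derivative_const]
  have "(\<Sum>j\<in>UNIV. of_nat (w j) * (1 *\<^sub>R v $ j) * \<gamma> 0 $ j ^ (w j - 1) * (\<Prod>l\<in>UNIV - {j}. \<gamma> 0 $ l ^ w l)) = 0"
    by meson
  \<comment> \<open>Each term of the product rule is the whole product times one logarithmic
    derivative; positivity of \<open>w j\<close> keeps the truncated exponent \<open>w j - 1\<close>
    correct.\<close>
  moreover have "of_nat (w j) * (1 *\<^sub>R v $ j) * \<gamma> 0 $ j ^ (w j - 1) * (\<Prod>l\<in>UNIV - {j}. \<gamma> 0 $ l ^ w l)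
      = of_nat (w j) * (v $ j / p $ j) * ?P" for j
  proof -
    have "?P = p $ j ^ w j * (\<Prod>l\<in>UNIV - {j}. p $ l ^ w l)"
      by (simp add: prod.remove[of UNIV j])
    moreover have "p $ j ^ w j = p $ j * p $ j ^ (w j - 1)"
      using w[of j] by (simp add: power_eq_if)
    ultimately show ?thesis using nz[of j] \<gamma>(3) by simp
  qed
  ultimately have "(\<Sum>j\<in>UNIV. of_nat (w j) * (v $ j / p $ j)) * ?P = 0"
    by (simp add: sum_distrib_right)
  moreover have "?P \<noteq> 0" using nz by simp
  ultimately show "(\<Sum>j\<in>UNIV. of_nat (w j) * (v $ j / p $ j)) = 0" by simp
qed

text \<open>Since cnj p_j * v_j = |p_j|^2 * (v_j / p_j) and |p_j|^2 is proportional to w_j, the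
  Hermitian product of \<open>p\<close> and \<open>v\<close> is a multiple of the logarithmic
  derivative of the weighted product, which is zero.\<close>

lemma tangent_weight_torus_subset_xi_std:
  fixes w :: "'n::finite \<Rightarrow> nat"
  assumes w: "\<And>j. w j > 0"
  shows "tangent_space (weight_torus w) p \<subseteq> xi_std p"
proof
  fix v assume v: "v \<in> tangent_space (weight_torus w) p"
  note t = tangent_weight_torus[OF w v]
  have "cnj (p $ j) * v $ j = of_nat (w j) * (v $ j / p $ j) / of_nat (\<Sum>l\<in>UNIV. w l)" for j
  proof -
    have nz: "p $ j \<noteq> 0" using weight_torus_component_nonzero[OF w t(3)] .
    then have "cnj (p $ j) * v $ j = (cnj (p $ j) * p $ j) * (v $ j / p $ j)" by simp
    then show ?thesis unfolding weight_torus_component_cnj[OF t(3)] by simp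
  qed
  then have "(\<Sum>j\<in>UNIV. cnj (p $ j) * v $ j) =
      (\<Sum>j\<in>UNIV. of_nat (w j) * (v $ j / p $ j)) / of_nat (\<Sum>l\<in>UNIV. w l)"
    by (simp only: sum_divide_distrib)
  then have z: "(\<Sum>j\<in>UNIV. cnj (p $ j) * v $ j) = 0" unfolding t(2) by simp
  have "p \<bullet> v = Re (\<Sum>j\<in>UNIV. cnj (p $ j) * v $ j)" "(\<i> *s p) \<bullet> v = Im (\<Sum>j\<in>UNIV. cnj (p $ j) * v $ j)"
    by (simp_all add: inner_vec_def inner_complex_def algebra_simps)
  moreover have "norm p = 1" using weight_torus_subset_sphere[of w] w t(3) by auto
  ultimately show "v \<in> xi_std p" using z by (simp add: xi_std_eq)
qed

section \<open>Logarithmic charts of weight tori\<close>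

lemma exp_eq_1_iff_small:
  assumes "\<bar>Im z\<bar> < 2 * pi" "Re z = 0"
  shows "exp z = 1 \<longleftrightarrow> Im z = 0"
proof
  assume "exp z = 1"
  then obtain n :: int where n: "Im z = of_int (2 * n) * pi" by (auto simp: exp_eq_1)
  then have "\<bar>of_int n\<bar> * (2 * pi) < 1 * (2 * pi)" using assms by (simp add: abs_mult)
  then have "\<bar>n\<bar> < 1" by (simp only: mult_less_cancel_right) (auto simp flip: of_int_abs)
  then show "Im z = 0" using n by simp
qed (use assms in \<open>simp add: complex_eq_iff Re_exp Im_exp\<close>)

lemma dim_imaginary_hyperplane:
  fixes w :: "'n::finite \<Rightarrow> nat"
  assumes "w k > 0"
  defines "P \<equiv> {y :: complex ^ 'n. (\<forall>j. Re (y $ j) = 0) \<and> (\<Sum>j\<in>UNIV. real (w j) * Im (y $ j)) = 0}"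
  shows "subspace P" and "dim P = CARD('n) - 1"
proof -
  show "subspace P"
    by (auto simp: P_def subspace_def algebra_simps sum.distrib simp flip: sum_distrib_left)
  let ?f = "\<lambda>s :: real ^ 'n. (\<chi> j. Complex 0 (s $ j))"
  let ?a = "\<chi> j. real (w j)"
  have f: "linear ?f"
    by (rule linearI) (simp_all add: vec_eq_iff complex_eq_iff)
  have inj: "inj ?f" by (simp add: inj_def vec_eq_iff)
  have "P = ?f ` {s. ?a \<bullet> s = 0}"
  proof (intro equalityI subsetI)
    fix y assume y: "y \<in> P"
    then show "y \<in> ?f ` {s. ?a \<bullet> s = 0}"
      by (intro image_eqI[where x="\<chi> j. Im (y $ j)"])
        (auto simp: P_def inner_vec_def vec_eq_iff complex_eq_iff)
  qed (auto simp: P_def inner_vec_def)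
  then have "dim P = dim {s. ?a \<bullet> s = 0}"
    using dim_image_eq[OF f, of "{s. ?a \<bullet> s = 0}"] inj by (simp add: inj_on_subset)
  moreover have "?a \<noteq> 0" using assms(1) by (auto simp: vec_eq_iff)
  ultimately show "dim P = CARD('n) - 1" by (simp add: dim_hyperplane)
qed

lemma Cinf_on_vec_nth: "open U \<Longrightarrow> Cinf_on U (\<lambda>z :: complex ^ 'n. z $ j)"
  by (intro Cinf_on_linear bounded_linear_vec_nth)

text \<open>The logarithmic coordinates \<open>z\<^sub>j = p\<^sub>j exp y\<^sub>j\<close> around \<open>p\<close> flatten the torus.\<close>

lemma weight_torus_submanifold:
  fixes w :: "'n::finite \<Rightarrow> nat"
  assumes w: "\<And>j. w j > 0"
  shows "embedded_submanifold (CARD('n) - 1) (weight_torus w)"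
  unfolding embedded_submanifold_def
proof
  fix p assume p: "p \<in> weight_torus w"
  have nz: "p $ j \<noteq> 0" for j using weight_torus_component_nonzero[OF w p] .
  define \<phi> where "\<phi> = (\<lambda>z :: complex ^ 'n. \<chi> j. Ln (z $ j / p $ j))"
  define \<psi> where "\<psi> = (\<lambda>y :: complex ^ 'n. \<chi> j. p $ j * exp (y $ j))"
  define U0 where "U0 = {z :: complex ^ 'n. \<forall>j. 0 < Re (z $ j / p $ j)}"
  \<comment> \<open>The bound pi / 2 makes \<open>Ln\<close> invert \<open>exp\<close> and sends
    \<open>V\<close> into the half planes of \<open>U0\<close>. The bound 2 * pi on the weighted sum
    leaves 0 as the only value at which its exponential is 1, so no parallel sheets of the torus
    enter the chart.\<close>
  define V where "V = {y :: complex ^ 'n. (\<forall>j. \<bar>Im (y $ j)\<bar> < pi / 2) \<and> \<bar>\<Sum>j\<in>UNIV. real (w j) * Im (y $ j)\<bar> < 2 * pi}"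
  define U where "U = U0 \<inter> \<phi> -` V"
  define P where "P = {y :: complex ^ 'n. (\<forall>j. Re (y $ j) = 0) \<and> (\<Sum>j\<in>UNIV. real (w j) * Im (y $ j)) = 0}"
  have U0: "open U0" unfolding U0_def Collect_all_eq
    by (intro open_INT ballI finite open_Collect_less continuous_intros) (use nz in auto)
  have V: "open V" unfolding V_def Collect_conj_eq Collect_all_eq
    by (intro open_Int open_INT ballI finite open_Collect_less continuous_intros)
  have smooth_\<phi>: "Cinf_on U0 \<phi>"
  proof (rule Cinf_on_vec[OF U0])
    fix j
    have Ln: "Cinf_on {z. 0 < Re z} Ln"
      by (intro Cinf_on_holomorphic holomorphic_intros open_halfspace_Re_gt)
        (auto simp: complex_nonpos_Reals_iff)
    have div: "Cinf_on U0 (\<lambda>z. z $ j * inverse (p $ j))"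
      by (intro Cinf_on_mult Cinf_on_const Cinf_on_vec_nth U0)
    have "(\<lambda>z. z $ j * inverse (p $ j)) ` U0 \<subseteq> {z. 0 < Re z}"
      by (auto simp: U0_def divide_inverse)
    from Cinf_on_compose[OF U0 open_halfspace_Re_gt this Ln div]
    have "Cinf_on U0 (\<lambda>z. Ln (z $ j * inverse (p $ j)))" .
    then show "Cinf_on U0 (\<lambda>z. \<phi> z $ j)" by (simp add: \<phi>_def divide_inverse)
  qed
  have smooth_\<psi>: "Cinf_on V \<psi>"
    by (rule Cinf_on_vec[OF V])
      (auto simp: \<psi>_def intro!: Cinf_on_mult Cinf_on_const Cinf_on_exp Cinf_on_vec_nth V)
  have U: "open U" unfolding U_def
    using continuous_open_preimage[OF Cinf_on_imp_continuous_on[OF smooth_\<phi>] U0 V] .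
  have \<phi>\<psi>: "\<phi> (\<psi> y) = y" if "y \<in> V" for y
  proof -
    have "Ln (exp (y $ j)) = y $ j" for j
    proof -
      have "\<bar>Im (y $ j)\<bar> < pi / 2" using that unfolding V_def by blast
      then show ?thesis using pi_gt_zero by (intro Ln_exp) linarith+
    qed
    then show ?thesis by (simp add: \<phi>_def \<psi>_def vec_eq_iff nz)
  qed
  have \<psi>\<phi>: "\<psi> (\<phi> z) = z" if "z \<in> U0" for z
  proof -
    have "z $ j \<noteq> 0" for j using that by (auto simp: U0_def dest: spec[of _ j])
    then show ?thesis by (simp add: \<phi>_def \<psi>_def vec_eq_iff nz)
  qed
  have \<psi>U: "\<psi> y \<in> U" if "y \<in> V" for y
  proof -
    have "\<bar>Im (y $ j)\<bar> < pi / 2" for j using that unfolding V_def by blast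
    then have "0 < cos (Im (y $ j))" for j
      by (intro cos_gt_zero_pi) (simp_all only: abs_less_iff minus_less_iff[of "pi / 2"])
    then have "\<psi> y \<in> U0" by (simp add: U0_def \<psi>_def nz Re_exp)
    then show ?thesis using that \<phi>\<psi>[OF that] by (simp add: U_def)
  qed
  have pU: "p \<in> U"
    using nz by (auto simp: U_def U0_def V_def \<phi>_def)
  have diffeo: "diffeomorphism U V \<phi> \<psi>"
    unfolding diffeomorphism_def
  proof (intro conjI)
    show "smooth_map U \<phi>"
      by (rule Cinf_on_imp_smooth_map[OF U0 smooth_\<phi>]) (simp add: U_def)
    show "smooth_map V \<psi>"
      by (rule Cinf_on_imp_smooth_map[OF V smooth_\<psi>]) simp
    have "y \<in> \<phi> ` U" if "y \<in> V" for y
      using \<phi>\<psi>[OF that] \<psi>U[OF that] by (metis imageI)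
    then show "\<phi> ` U = V" by (auto simp: U_def)
    have "z \<in> \<psi> ` V" if "z \<in> U" for z
      using \<psi>\<phi>[of z] that unfolding U_def by (metis IntE imageI vimageE)
    then show "\<psi> ` V = U" using \<psi>U by auto
  qed (use \<phi>\<psi> \<psi>\<phi> in \<open>auto simp: U_def\<close>)
  have torus_iff: "\<psi> y \<in> weight_torus w \<longleftrightarrow> y \<in> P" if y: "y \<in> V" for y
  proof -
    have "cmod (\<psi> y $ j) = weight_radius w j \<longleftrightarrow> Re (y $ j) = 0" for j
      using p weight_radius_pos[of w j] w by (simp add: \<psi>_def norm_mult weight_torus_def)
    moreover have "(\<Prod>j\<in>UNIV. \<psi> y $ j ^ w j) = of_real (\<Prod>j\<in>UNIV. weight_radius w j ^ w j) \<longleftrightarrow>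
        (\<Sum>j\<in>UNIV. real (w j) * Im (y $ j)) = 0" if re: "\<forall>j. Re (y $ j) = 0"
    proof -
      let ?s = "\<Sum>j\<in>UNIV. of_nat (w j) * y $ j"
      have cancel: "x = q * e \<Longrightarrow> q = r \<Longrightarrow> q \<noteq> 0 \<Longrightarrow> x = r \<longleftrightarrow> e = 1" for x q e r :: complex
        by auto
      have 1: "(\<Prod>j\<in>UNIV. \<psi> y $ j ^ w j) = (\<Prod>j\<in>UNIV. p $ j ^ w j) * exp ?s"
        by (simp add: \<psi>_def power_mult_distrib prod.distrib exp_sum exp_of_nat_mult)
      have 2: "(\<Prod>j\<in>UNIV. p $ j ^ w j) = of_real (\<Prod>j\<in>UNIV. weight_radius w j ^ w j)"
        using p by (simp add: weight_torus_def)
      have 3: "(\<Prod>j\<in>UNIV. p $ j ^ w j) \<noteq> 0" using nz by simp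
      have "(\<Prod>j\<in>UNIV. \<psi> y $ j ^ w j) = of_real (\<Prod>j\<in>UNIV. weight_radius w j ^ w j) \<longleftrightarrow> exp ?s = 1"
        by (rule cancel[OF 1 2 3])
      also have "\<dots> \<longleftrightarrow> Im ?s = 0"
        using y re by (intro exp_eq_1_iff_small) (auto simp: V_def)
      finally show ?thesis by simp
    qed
    ultimately show ?thesis unfolding weight_torus_def P_def by auto
  qed
  have "\<phi> ` (U \<inter> weight_torus w) = V \<inter> P"
  proof (intro equalityI subsetI)
    fix y assume "y \<in> \<phi> ` (U \<inter> weight_torus w)"
    then obtain z where z: "z \<in> U" "z \<in> weight_torus w" "y = \<phi> z" by blast
    then have "y \<in> V" "\<psi> y = z" using \<psi>\<phi> by (auto simp: U_def)
    then show "y \<in> V \<inter> P" using torus_iff z by blast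
  next
    fix y assume y: "y \<in> V \<inter> P"
    then show "y \<in> \<phi> ` (U \<inter> weight_torus w)"
      using \<phi>\<psi> \<psi>U torus_iff by (intro image_eqI[where x="\<psi> y"]) auto
  qed
  moreover have "subspace P" "dim P = CARD('n) - 1"
    unfolding P_def using dim_imaginary_hyperplane[of w] w by blast+
  ultimately show "\<exists>U V (\<phi> :: complex ^ 'n \<Rightarrow> complex ^ 'n) \<psi> P. open U \<and> p \<in> U \<and> open V \<and> diffeomorphism U V \<phi> \<psi> \<and>
        subspace P \<and> dim P = CARD('n) - 1 \<and> \<phi> ` (U \<inter> weight_torus w) = V \<inter> P"
    using U V pU diffeo
    by (intro exI[of _ U] exI[of _ V] exI[of _ \<phi>] exI[of _ \<psi>] exI[of _ P]) simp
qed

lemma legendrian_weight_torus: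
  fixes w :: "'n::finite \<Rightarrow> nat"
  assumes "\<And>j. w j > 0"
  shows "legendrian (weight_torus w)"
  unfolding legendrian_def
  using weight_torus_subset_sphere weight_torus_submanifold tangent_weight_torus_subset_xi_std assms
  by blast

section \<open>Parametrization of weight tori\<close>

text \<open>For weight 1 at \<open>k\<close>, the product equation is solved for coordinate
  \<open>k\<close>. Inverses of unit numbers are written as conjugates, which keeps the map smooth
  on the whole space; the entry \<open>u $ k\<close> is ignored.\<close>

definition torus_embedding :: "('n::finite \<Rightarrow> nat) \<Rightarrow> 'n \<Rightarrow> complex ^ 'n \<Rightarrow> complex ^ 'n" where
  "torus_embedding w k u = (\<chi> j. of_real (weight_radius w j) *
     (if j = k then \<Prod>l\<in>UNIV - {k}. cnj (u $ l) ^ w l else u $ j))"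

lemma Cinf_on_torus_embedding: "Cinf_on UNIV (torus_embedding w k)"
proof (rule Cinf_on_vec[OF open_UNIV])
  fix j
  have "Cinf_on UNIV (\<lambda>u. complex_of_real (weight_radius w k) * (\<Prod>l\<in>UNIV - {k}. cnj (u $ l) ^ w l))"
    by (intro Cinf_on_mult Cinf_on_const Cinf_on_prod Cinf_on_power open_UNIV
        Cinf_on_bounded_linear[OF bounded_linear_cnj] Cinf_on_vec_nth)
  moreover have "Cinf_on UNIV (\<lambda>u. complex_of_real (weight_radius w j) * u $ j)"
    by (intro Cinf_on_mult Cinf_on_const Cinf_on_vec_nth open_UNIV)
  ultimately show "Cinf_on UNIV (\<lambda>u. torus_embedding w k u $ j)"
    by (cases "j = k") (simp_all add: torus_embedding_def)
qed

lemma torus_embedding_in_weight_torus: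
  assumes "w k = 1" "\<And>j. j \<noteq> k \<Longrightarrow> cmod (u $ j) = 1"
  shows "torus_embedding w k u \<in> weight_torus w"
proof -
  have unit: "cnj (u $ j) * u $ j = 1" if "j \<noteq> k" for j
    using complex_norm_square[of "u $ j"] assms(2)[OF that] by (simp add: mult.commute)
  have r: "weight_radius w j \<ge> 0" for j
    by (simp add: weight_radius_def sum_nonneg)
  have "cmod (torus_embedding w k u $ j) = weight_radius w j" for j
  proof (cases "j = k")
    case True
    have "(\<Prod>l\<in>UNIV - {k}. cmod (u $ l) ^ w l) = 1"
      by (rule prod.neutral) (simp add: assms(2))
    then show ?thesis
      using True r[of k] by (simp add: torus_embedding_def norm_mult norm_power flip: prod_norm)
  qed (simp add: torus_embedding_def norm_mult assms(2) r)
  moreover have "(\<Prod>j\<in>UNIV. torus_embedding w k u $ j ^ w j) = of_real (\<Prod>j\<in>UNIV. weight_radius w j ^ w j)"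
  proof -
    have "(\<Prod>j\<in>UNIV. torus_embedding w k u $ j ^ w j) =
        of_real (weight_radius w k) * (\<Prod>l\<in>UNIV - {k}. cnj (u $ l) ^ w l) *
        (\<Prod>l\<in>UNIV - {k}. (of_real (weight_radius w l) * u $ l) ^ w l)"
      by (simp add: prod.remove[of UNIV k] torus_embedding_def assms(1))
    also have "\<dots> = of_real (weight_radius w k) *
        (\<Prod>l\<in>UNIV - {k}. of_real (weight_radius w l) ^ w l * (cnj (u $ l) * u $ l) ^ w l)"
      by (simp add: prod.distrib power_mult_distrib mult_ac)
    also have "(\<Prod>l\<in>UNIV - {k}. complex_of_real (weight_radius w l) ^ w l * (cnj (u $ l) * u $ l) ^ w l)
        = (\<Prod>l\<in>UNIV - {k}. of_real (weight_radius w l) ^ w l)"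
      by (intro prod.cong) (auto simp: unit)
    finally show ?thesis by (simp add: prod.remove[of UNIV k] assms(1))
  qed
  ultimately show ?thesis by (simp add: weight_torus_def)
qed

text \<open>As \<open>k\<close> has weight 1, the product equation is linear in coordinate
  \<open>k\<close>, with a nonzero coefficient given by the others.\<close>

lemma weight_torus_eqI:
  assumes w: "\<And>j. w j > 0" "w k = 1" and z: "z \<in> weight_torus w" "z' \<in> weight_torus w"
    and eq: "\<And>j. j \<noteq> k \<Longrightarrow> z $ j = z' $ j"
  shows "z = z'"
proof -
  have split: "(\<Prod>j\<in>UNIV. y $ j ^ w j) = y $ k * (\<Prod>j\<in>UNIV - {k}. y $ j ^ w j)" for y :: "complex ^ 'a"
    by (simp add: prod.remove[of UNIV k] w)
  have "(\<Prod>j\<in>UNIV. z $ j ^ w j) = (\<Prod>j\<in>UNIV. z' $ j ^ w j)"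
    using z by (simp add: weight_torus_def)
  moreover have "(\<Prod>j\<in>UNIV - {k}. z $ j ^ w j) = (\<Prod>j\<in>UNIV - {k}. z' $ j ^ w j)"
    by (intro prod.cong) (auto simp: eq)
  moreover have "(\<Prod>j\<in>UNIV - {k}. z' $ j ^ w j) \<noteq> 0"
    using weight_torus_component_nonzero[OF w(1) z(2)] by simp
  ultimately have "z $ k = z' $ k" by (simp add: split)
  then show ?thesis using eq by (metis vec_eq_iff)
qed

lemma diffeomorphic_torus_weight_torus:
  fixes w :: "'n::finite \<Rightarrow> nat"
  assumes w: "\<And>j. w j > 0" "w k = 1" and card: "CARD('m::finite) = CARD('n) - 1"
  shows "diffeomorphic (torus :: (complex ^ 'm) set) (weight_torus w)"
proof -
  have "card (UNIV :: 'm set) = card (UNIV - {k})" using card by (simp add: card_Diff_singleton)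
  then obtain \<sigma> where \<sigma>: "bij_betw \<sigma> (UNIV :: 'm set) (UNIV - {k})"
    using finite_same_card_bij by (metis finite)
  \<comment> \<open>The value \<open>\<tau> k\<close> is unspecified, harmlessly so:
    \<open>torus_embedding w k\<close> does not read entry \<open>k\<close>.\<close>
  define \<tau> where "\<tau> = inv_into UNIV \<sigma>"
  have \<tau>\<sigma>: "\<tau> (\<sigma> i) = i" and \<sigma>k: "\<sigma> i \<noteq> k" for i
    using \<sigma> by (auto simp: \<tau>_def bij_betw_def)
  have \<sigma>\<tau>: "\<sigma> (\<tau> j) = j" if "j \<noteq> k" for j
    using \<sigma> that unfolding \<tau>_def by (metis DiffI UNIV_I bij_betw_inv_into_right singletonD)
  define f where "f = (\<lambda>u :: complex ^ 'm. torus_embedding w k (\<chi> j. u $ \<tau> j))"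
  define g where "g = (\<lambda>z :: complex ^ 'n. \<chi> i. inverse (complex_of_real (weight_radius w (\<sigma> i))) * z $ \<sigma> i)"
  have r: "weight_radius w j > 0" for j using weight_radius_pos w by blast
  have f: "f u \<in> weight_torus w" if "u \<in> torus" for u
    unfolding f_def by (rule torus_embedding_in_weight_torus[of w k, OF w(2)]) (use that in \<open>simp add: torus_def\<close>)
  have g: "g z \<in> torus" if "z \<in> weight_torus w" for z
    using that less_imp_neq[OF r] by (auto simp: g_def torus_def weight_torus_def norm_mult norm_inverse less_imp_le[OF r])
  have gf: "g (f u) = u" for u
    using less_imp_neq[OF r] by (simp add: g_def f_def torus_embedding_def vec_eq_iff \<tau>\<sigma> \<sigma>k)
  have fg: "f (g z) = z" if "z \<in> weight_torus w" for z
  proof (rule weight_torus_eqI[OF w f[OF g[OF that]] that])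
    fix j assume "j \<noteq> k"
    then show "f (g z) $ j = z $ j"
      using less_imp_neq[OF r, of j] by (simp add: g_def f_def torus_embedding_def \<sigma>\<tau>)
  qed
  have "Cinf_on UNIV (\<lambda>u :: complex ^ 'm. (\<chi> j. u $ \<tau> j) :: complex ^ 'n)"
    by (rule Cinf_on_vec) (auto intro: Cinf_on_vec_nth)
  then have "Cinf_on UNIV f" unfolding f_def
    by (intro Cinf_on_compose[OF _ _ _ Cinf_on_torus_embedding]) auto
  then have "smooth_map torus f" by (rule Cinf_on_imp_smooth_map[rotated]) auto
  moreover have "Cinf_on UNIV g"
    by (rule Cinf_on_vec) (auto simp: g_def intro!: Cinf_on_mult Cinf_on_const Cinf_on_vec_nth)
  then have "smooth_map (weight_torus w) g" by (rule Cinf_on_imp_smooth_map[rotated]) auto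
  moreover have "f ` torus = weight_torus w"
  proof (intro equalityI subsetI)
    fix z assume "z \<in> weight_torus w"
    then show "z \<in> f ` torus" by (intro image_eqI[where x="g z"]) (simp_all add: fg g)
  qed (use f in blast)
  moreover have "g ` weight_torus w = torus"
  proof (intro equalityI subsetI)
    fix u :: "complex ^ 'm" assume "u \<in> torus"
    then show "u \<in> g ` weight_torus w" by (intro image_eqI[where x="f u"]) (simp_all add: gf f)
  qed (use g in blast)
  ultimately show ?thesis
    unfolding diffeomorphic_def diffeomorphism_def using fg gf by blast
qed

text \<open>A periodic parametrization by angles that is constant in the dummy direction
  \<open>k\<close>.\<close>

definition torus_param :: "('n::finite \<Rightarrow> nat) \<Rightarrow> 'n \<Rightarrow> real ^ 'n \<Rightarrow> complex ^ 'n" where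
  "torus_param w k s = torus_embedding w k (\<chi> j. exp (\<i> * of_real (s $ j)))"

lemma torus_param_in_weight_torus: "w k = 1 \<Longrightarrow> torus_param w k s \<in> weight_torus w"
  unfolding torus_param_def by (rule torus_embedding_in_weight_torus) auto

lemma Cinf_on_torus_param: "Cinf_on UNIV (torus_param w k)"
proof -
  have "Cinf_on UNIV (\<lambda>s :: real ^ 'a. (\<chi> j. exp (\<i> * of_real (s $ j))) :: complex ^ 'a)"
  proof (rule Cinf_on_vec[OF open_UNIV])
    fix j
    have "Cinf_on UNIV (\<lambda>s :: real ^ 'a. exp (\<i> * complex_of_real (s $ j)))"
      by (intro Cinf_on_exp Cinf_on_linear open_UNIV bounded_linear_const_mult
          bounded_linear_compose[OF bounded_linear_of_real] bounded_linear_vec_nth)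
    then show "Cinf_on UNIV (\<lambda>s :: real ^ 'a. ((\<chi> j. exp (\<i> * of_real (s $ j))) :: complex ^ 'a) $ j)"
      by simp
  qed
  then show ?thesis unfolding torus_param_def
    by (intro Cinf_on_compose[OF _ _ _ Cinf_on_torus_embedding]) auto
qed

lemma torus_param_nth:
  "j \<noteq> k \<Longrightarrow> torus_param w k s $ j = of_real (weight_radius w j) * exp (\<i> * of_real (s $ j))"
  by (simp add: torus_param_def torus_embedding_def)

lemma torus_param_periodic:
  fixes s :: "real ^ 'n::finite"
  shows "torus_param w k (s + axis i (2 * pi)) = torus_param w k s"
proof -
  have "exp (\<i> * complex_of_real ((s + axis i (2 * pi)) $ j)) = exp (\<i> * complex_of_real (s $ j))" for j
  proof -
    have "exp (\<i> * complex_of_real (2 * pi)) = 1" by (auto simp: exp_eq_1 intro: exI[of _ 1])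
    then show ?thesis by (cases "j = i") (simp_all add: axis_def distrib_left exp_add)
  qed
  then show ?thesis by (simp add: torus_param_def)
qed

text \<open>Each coordinate \<open>j\<close> other than \<open>k\<close> depends on the angle s_j
  alone, with nonzero speed, so only the dummy direction is collapsed.\<close>

lemma torus_param_derivative_kernel:
  fixes w :: "'n::finite \<Rightarrow> nat"
  assumes w: "\<And>j. w j > 0" and v: "frechet_derivative (torus_param w k) (at s) v = 0" "v $ k = 0"
  shows "v = 0"
proof -
  have "v $ j = 0" if j: "j \<noteq> k" for j
  proof -
    let ?e = "\<lambda>s :: real ^ 'n. complex_of_real (weight_radius w j) * exp (\<i> * of_real (s $ j))"
    have "((\<lambda>s. torus_param w k s $ j) has_derivative (\<lambda>v. frechet_derivative (torus_param w k) (at s) v $ j)) (at s)"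
      by (intro bounded_linear.has_derivative[OF bounded_linear_vec_nth] Cinf_on_has_derivative[OF Cinf_on_torus_param]) simp
    then have d: "(?e has_derivative (\<lambda>v. frechet_derivative (torus_param w k) (at s) v $ j)) (at s)"
      by (simp add: torus_param_nth[OF j])
    have "(?e has_derivative (\<lambda>v. of_real (weight_radius w j) * (exp (\<i> * of_real (s $ j)) * (\<i> * of_real (v $ j))))) (at s)"
      by (intro has_derivative_mult_right has_derivative_of_real
          has_derivative_compose[OF _ DERIV_exp[unfolded has_field_derivative_def]]
          bounded_linear_imp_has_derivative bounded_linear_vec_nth)
    from fun_cong[OF has_derivative_unique[OF this d], of v]
    have "of_real (weight_radius w j) * (exp (\<i> * of_real (s $ j)) * (\<i> * of_real (v $ j))) =
        frechet_derivative (torus_param w k) (at s) v $ j" .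
    then show ?thesis using v weight_radius_pos[of w j] w by simp
  qed
  then show ?thesis using v(2) by (metis vec_eq_iff zero_index)
qed

section \<open>The winding number of the frame determinant\<close>

text \<open>For maps that factor through \<open>torus_param w k\<close>, row \<open>k\<close> of the
  Jacobian is zero; the point takes its place.\<close>

definition frame_det :: "(real ^ 'n \<Rightarrow> complex ^ 'n) \<Rightarrow> 'n::finite \<Rightarrow> real ^ 'n \<Rightarrow> complex" where
  "frame_det h k s = det (\<chi> r. if r = k then h s else frechet_derivative h (at s) (axis r 1))"

text \<open>Every tangent vector of the torus is, coordinate by coordinate, an imaginary multiple of
  the point, so each derivative row contributes \<i> and the row of the point contributes 1. An
  arbitrary \<open>h\<close> is allowed because the end of an isotopy comes with an unknown
  parametrization.\<close>

lemma frame_det_weight_torus: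
  fixes w :: "'n::finite \<Rightarrow> nat"
  assumes w: "\<And>j. w j > 0" and h: "Cinf_on UNIV h" "range h \<subseteq> weight_torus w"
  shows "\<exists>r. frame_det h k s = (\<Prod>j\<in>UNIV. if j = k then 1 else \<i>) * of_real r * (\<Prod>l\<in>UNIV. h s $ l)"
proof -
  let ?v = "\<lambda>j. frechet_derivative h (at s) (axis j 1)"
  define X where "X = (\<lambda>j l. if j = k then 1 else Im (?v j $ l / h s $ l))"
  have "?v j $ l = \<i> * of_real (Im (?v j $ l / h s $ l)) * h s $ l" for j l
  proof -
    have t: "?v j \<in> tangent_space (weight_torus w) (h s)" by (rule tangent_space_range[OF h])
    have "h s \<in> weight_torus w" using h(2) by blast
    then have nz: "h s $ l \<noteq> 0" using weight_torus_component_nonzero w by blast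
    have "Re (?v j $ l / h s $ l) = Re (cnj (h s $ l) * ?v j $ l) / (cmod (h s $ l))\<^sup>2"
      by (simp add: Re_divide cmod_def mult.commute)
    then have "Re (?v j $ l / h s $ l) = 0" using tangent_weight_torus(1)[OF w t] by simp
    then have "?v j $ l / h s $ l = \<i> * of_real (Im (?v j $ l / h s $ l))"
      by (simp only: complex_eq_iff) simp
    then show ?thesis using nz by (metis nonzero_eq_divide_eq)
  qed
  then have eq: "(\<chi> r. if r = k then h s else ?v r) =
      (\<chi> r l. (if r = k then 1 else \<i>) * of_real (X r l) * h s $ l)"
    by (simp add: vec_eq_iff X_def)
  show ?thesis
    by (rule exI[of _ "det (\<chi> r l. X r l)"]) (simp only: frame_det_def eq det_real_rotated)
qed

lemma frame_det_periodic:
  assumes h: "Cinf_on UNIV h" and per: "\<And>s. h (s + p) = h s"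
  shows "frame_det h k (s + p) = frame_det h k s"
proof -
  have "((\<lambda>s. h (s + p)) has_derivative (\<lambda>v. frechet_derivative h (at (s + p)) v)) (at s)"
    by (rule has_derivative_compose[where f="\<lambda>s. s + p" and f'="\<lambda>v. v"])
      (use Cinf_on_has_derivative[OF h] in \<open>auto intro!: derivative_eq_intros\<close>)
  then have "(h has_derivative frechet_derivative h (at (s + p))) (at s)" by (simp add: per)
  then have eq: "frechet_derivative h (at (s + p)) = frechet_derivative h (at s)"
    by (rule frechet_derivative_at)
  show ?thesis unfolding frame_det_def per eq ..
qed

section \<open>Continuous determinants and lifted phases\<close>

lemma continuous_on_det:
  fixes A :: "'a::topological_space \<Rightarrow> complex ^ 'n ^ 'n"
  assumes "\<And>i j. continuous_on S (\<lambda>x. A x $ i $ j)"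
  shows "continuous_on S (\<lambda>x. det (A x))"
  unfolding det_def
  by (intro continuous_on_sum continuous_on_mult continuous_on_prod continuous_on_const assms)

text \<open>All values of \<open>u\<close> lie in one coset of the multiples of 2 * pi, so distinct
  values are at least 2 * pi apart, and a continuous function on a connected set cannot
  jump.\<close>

lemma constant_on_cis_eq:
  fixes u :: "'a::topological_space \<Rightarrow> real"
  assumes "connected S" "continuous_on S u" "\<And>x. x \<in> S \<Longrightarrow> cis (u x) = c"
  shows "u constant_on S"
proof (rule continuous_discrete_range_constant[OF assms(1,2)])
  fix x assume x: "x \<in> S"
  have "2 * pi \<le> norm (u y - u x)" if y: "y \<in> S" "u y \<noteq> u x" for y
  proof -
    have "cis (u y) = cis (u x)" using assms(3) x y by simp
    then have "cis (u y - u x) = 1" by (simp flip: cis_divide)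
    then have "exp (\<i> * of_real (u y - u x)) = 1" by (simp add: cis_conv_exp)
    then have "\<not> \<bar>Im (\<i> * of_real (u y - u x))\<bar> < 2 * pi"
      using exp_eq_1_iff_small[of "\<i> * of_real (u y - u x)"] y by auto
    then show ?thesis by simp
  qed
  then show "\<exists>e>0. \<forall>y. y \<in> S \<and> u y \<noteq> u x \<longrightarrow> e \<le> norm (u y - u x)"
    by (intro exI[of _ "2 * pi"]) auto
qed

lemma sgn_exp_complex: "sgn (exp z) = cis (Im z)" for z :: complex
proof -
  have "sgn (exp z) = exp z / of_real (exp (Re z))" by (simp add: sgn_eq)
  also have "\<dots> = cis (Im z)" by (subst exp_eq_polar) simp
  finally show ?thesis .
qed

text \<open>Multiplying the two equations shows that exp (l + a * m) stays on the real line through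
  \<open>C\<close>, so the imaginary part of l + a * m cannot change on \<open>S\<close>.\<close>

lemma phase_increment:
  fixes l m :: "real \<Rightarrow> complex"
  assumes "connected S" and cont: "continuous_on S l" "continuous_on S m"
    and l: "\<And>x. x \<in> S \<Longrightarrow> exp (l x) = C * of_real (r x) * P x"
    and m: "\<And>x. x \<in> S \<Longrightarrow> P x * exp (m x) ^ a = of_real R" and R: "R > 0"
    and xy: "x \<in> S" "y \<in> S"
  shows "Im (l y) - Im (l x) = - real a * (Im (m y) - Im (m x))"
proof -
  \<comment> \<open>The factor 2 squares the exponential and removes the sign of \<open>r x\<close>,
    which need not be continuous in \<open>x\<close>.\<close>
  let ?u = "\<lambda>x. 2 * (Im (l x) + real a * Im (m x))"
  have "cis (?u x) = sgn (C\<^sup>2)" if x: "x \<in> S" for x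
  proof -
    let ?z = "2 * (l x + of_nat a * m x)"
    have "exp (l x + of_nat a * m x) = C * of_real (r x) * (P x * exp (m x) ^ a)"
      by (simp add: exp_add exp_of_nat_mult l[OF x])
    then have *: "exp (l x + of_nat a * m x) = C * of_real (r x * R)"
      by (simp add: m[OF x])
    then have nz: "r x * R \<noteq> 0" by (metis exp_not_eq_zero mult_zero_right of_real_0)
    have "exp ?z = C\<^sup>2 * of_real ((r x * R)\<^sup>2)"
      unfolding exp_double * by (simp add: power_mult_distrib)
    then have "sgn (exp ?z) = sgn (C\<^sup>2) * of_real (sgn ((r x * R)\<^sup>2))"
      by (simp only: sgn_mult sgn_of_real)
    also have "sgn ((r x * R)\<^sup>2) = 1" by (rule sgn_pos) (use nz in simp)
    finally show ?thesis by (simp add: sgn_exp_complex)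
  qed
  then have "?u constant_on S"
    by (intro constant_on_cis_eq[OF assms(1)] continuous_intros cont) auto
  then have "?u y = ?u x" using xy unfolding constant_on_def by metis
  then show ?thesis by (simp add: algebra_simps)
qed

section \<open>The family with a single large weight, and divisibility\<close>

definition spiked_weight :: "'n::finite \<Rightarrow> nat \<Rightarrow> 'n \<Rightarrow> nat" where
  "spiked_weight i a j = (if j = i then Suc a else 1)"

lemma spiked_weight_simps [simp]:
  "spiked_weight i a j > 0" "j \<noteq> i \<Longrightarrow> spiked_weight i a j = 1"
  by (auto simp: spiked_weight_def)

text \<open>This factorization ties the phase of the coordinate product, hence of the frame
  determinant, to \<open>a\<close> times the phase of coordinate \<open>i\<close>.\<close>

lemma prod_spiked_weight:
  fixes z :: "complex ^ 'n"
  shows "(\<Prod>j\<in>UNIV. z $ j ^ spiked_weight i a j) = (\<Prod>j\<in>UNIV. z $ j) * z $ i ^ a"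
proof -
  have "(\<Prod>j\<in>UNIV - {i}. z $ j ^ spiked_weight i a j) = (\<Prod>j\<in>UNIV - {i}. z $ j)"
    by (intro prod.cong) auto
  then show ?thesis by (simp add: prod.remove[of UNIV i] spiked_weight_def)
qed

text \<open>The total phase change of the frame determinant around one loop is computed at both ends
  of the isotopy: it is -2 * pi * a at the start and -2 * pi * b * N at the end, for some integer
  N.\<close>

lemma legendrian_isotopic_imp_dvd:
  fixes i k :: "'n::finite"
  assumes ik: "i \<noteq> k"
    and iso: "legendrian_isotopic (weight_torus (spiked_weight i a)) (weight_torus (spiked_weight i b))"
  shows "b dvd a"
proof -
  let ?L = "\<lambda>a. weight_torus (spiked_weight i a)"
  let ?\<Phi> = "torus_param (spiked_weight i a) k"
  obtain F :: "(complex ^ 'n) \<times> real \<Rightarrow> complex ^ 'n" where F: "smooth_map (?L a \<times> {0..1}) F"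
    and leg: "\<And>t. t \<in> {0..1} \<Longrightarrow> legendrian ((\<lambda>x. F (x, t)) ` ?L a)"
    and emb: "\<And>t. t \<in> {0..1} \<Longrightarrow> \<exists>g. diffeomorphism (?L a) ((\<lambda>x. F (x, t)) ` ?L a) (\<lambda>x. F (x, t)) g"
    and F0: "\<And>x. x \<in> ?L a \<Longrightarrow> F (x, 0) = x" and F1: "(\<lambda>x. F (x, 1)) ` ?L a = ?L b"
    using iso unfolding legendrian_isotopic_def by blast
  have \<Phi>: "?\<Phi> s \<in> ?L a" for s
    by (rule torus_param_in_weight_torus) (use ik in auto)
  define H where "H = (\<lambda>z. F (?\<Phi> (fst z), snd z))"
  have "Cinf_on UNIV (\<lambda>z :: (real ^ 'n) \<times> real. (?\<Phi> (fst z), snd z))"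
    by (intro Cinf_on_Pair Cinf_on_compose[OF _ _ _ Cinf_on_torus_param] Cinf_on_linear bounded_linear_intros) auto
  then have smooth_H: "smooth_map (UNIV \<times> {0..1}) H" unfolding H_def
    by (rule smooth_map_compose[OF open_UNIV _ _ _ F]) (use \<Phi> in auto)
  define h where "h = (\<lambda>t s. H (s, t))"
  have h: "Cinf_on UNIV (h t)" if "t \<in> {0..1}" for t
    unfolding h_def by (rule smooth_map_slice[OF smooth_H that])
  have rh: "range (h t) \<subseteq> (\<lambda>x. F (x, t)) ` ?L a" for t
    using \<Phi> by (auto simp: h_def H_def)
  \<comment> \<open>The loop, over [0, 2 * pi], that turns angle \<open>i\<close> once and leaves
    the other angles at 0.\<close>
  define \<theta> where "\<theta> = (\<lambda>x. x *\<^sub>R axis i 1 :: real ^ 'n)"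
  define D where "D = (\<lambda>z. frame_det (h (snd z)) k (\<theta> (fst z)))"
  let ?S = "{0..2 * pi} \<times> {0..1::real}"
  have cont_\<theta>: "continuous_on A \<theta>" for A
    unfolding \<theta>_def by (intro continuous_intros)
  have "continuous_on (UNIV \<times> {0..1}) H"
    by (rule smooth_map_imp_continuous_on[OF smooth_H])
  moreover have cont_slice: "continuous_on ?S (\<lambda>z. (\<theta> (fst z), snd z))"
    by (auto intro!: continuous_intros continuous_on_compose2[OF cont_\<theta>[of UNIV]])
  ultimately have cont_H: "continuous_on ?S (\<lambda>z. h (snd z) (\<theta> (fst z)))"
    unfolding h_def by (rule continuous_on_compose2) auto
  have cont_dH: "continuous_on ?S (\<lambda>z. frechet_derivative (h (snd z)) (at (\<theta> (fst z))) v)" for v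
    using continuous_on_compose2[OF continuous_on_slice_derivative[OF smooth_H, of v] cont_slice]
    by (simp add: h_def image_subset_iff)
  have cont_D: "continuous_on ?S D"
    unfolding D_def frame_det_def
  proof (rule continuous_on_det)
    fix j l
    show "continuous_on ?S (\<lambda>z. (\<chi> r. if r = k then h (snd z) (\<theta> (fst z))
        else frechet_derivative (h (snd z)) (at (\<theta> (fst z))) (axis r 1)) $ j $ l)"
      using cont_H by (cases "j = k") (auto intro!: continuous_intros cont_dH)
  qed
  have D_nz: "D z \<noteq> 0" if "z \<in> ?S" for z
  proof -
    let ?t = "snd z" and ?s = "\<theta> (fst z)"
    have t: "?t \<in> {0..1}" using that by auto
    note p = legendrian_param[OF leg[OF t] h[OF t] rh]
    have d: "(h ?t has_derivative frechet_derivative (h ?t) (at ?s)) (at ?s)"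
      using Cinf_on_has_derivative[OF h[OF t]] by simp
    obtain g where g: "diffeomorphism (?L a) ((\<lambda>x. F (x, ?t)) ` ?L a) (\<lambda>x. F (x, ?t)) g"
      using emb[OF t] by blast
    show ?thesis unfolding D_def frame_det_def
    proof (rule det_legendrian_frame)
      show "linear (frechet_derivative (h ?t) (at ?s))" using has_derivative_linear[OF d] .
      show "h ?t ?s \<noteq> 0" using p(1)[of ?s] by auto
      fix v assume v: "frechet_derivative (h ?t) (at ?s) v = 0" "v $ k = 0"
      \<comment> \<open>The inverse \<open>g\<close> of the embedding at time \<open>?t\<close>
        recovers \<open>?\<Phi>\<close> from \<open>h ?t\<close>, so a vector killed by the
        differential of \<open>h ?t\<close> is killed by that of \<open>?\<Phi>\<close>, and the
        latter collapses only direction \<open>k\<close>.\<close>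
      have "frechet_derivative ?\<Phi> (at ?s) v = 0"
      proof (rule kernel_derivative_left_inverse[OF _ rh d])
        show "smooth_map ((\<lambda>x. F (x, ?t)) ` ?L a) g" using g by (simp add: diffeomorphism_def)
        show "g (h ?t x) = ?\<Phi> x" for x using g \<Phi> by (simp add: diffeomorphism_def h_def H_def)
        show "(?\<Phi> has_derivative frechet_derivative ?\<Phi> (at ?s)) (at ?s)"
          by (rule Cinf_on_has_derivative[OF Cinf_on_torus_param]) simp
      qed (use v Cinf_on_imp_continuous_on[OF h[OF t]] in auto)
      then show "v = 0" using torus_param_derivative_kernel v(2) by (metis spiked_weight_simps(1))
    qed (use p in auto)
  qed
  have "convex ?S" by (intro convex_Times) auto
  \<comment> \<open>The rectangle loop parameter times time is contractible, so one continuous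
    logarithm of the determinant serves all times at once.\<close>
  then obtain l where l: "continuous_on ?S l" "\<And>z. z \<in> ?S \<Longrightarrow> D z = exp (l z)"
    using continuous_logarithm_on_contractible[OF cont_D convex_imp_contractible] D_nz by blast
  define turn where "turn = (\<lambda>t. Im (l (2 * pi, t)) - Im (l (0, t)))"
  have \<theta>_per: "\<theta> (2 * pi) = \<theta> 0 + axis i (2 * pi)"
    by (simp add: \<theta>_def vec_eq_iff axis_def)
  have h_per: "h t (s + axis i (2 * pi)) = h t s" for t s
    by (simp add: h_def H_def torus_param_periodic)
  \<comment> \<open>Periodicity forces each increment to be a multiple of 2 * pi, and continuity in
    time then freezes it.\<close>
  have "turn constant_on {0..1}"
  proof (rule constant_on_cis_eq)
    show "continuous_on {0..1} turn" unfolding turn_def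
      by (intro continuous_intros continuous_on_compose2[OF l(1)]) auto
    fix t :: real assume t: "t \<in> {0..1}"
    have "D (2 * pi, t) = D (0, t)"
      using frame_det_periodic[OF h[OF t] h_per] by (simp add: D_def \<theta>_per)
    then have "exp (l (2 * pi, t)) = exp (l (0, t))" using l(2) t by simp
    then have "cis (Im (l (2 * pi, t))) = cis (Im (l (0, t)))" by (metis sgn_exp_complex)
    then show "cis (turn t) = 1" by (simp add: turn_def flip: cis_divide)
  qed auto
  then have turn: "turn 0 = turn 1" unfolding constant_on_def by (metis atLeastAtMost_iff order_refl zero_le_one)
  \<comment> \<open>Meant for t = 0 with \<open>c = a\<close> and for t = 1 with
    \<open>c = b\<close>, where the image is a weight torus; \<open>m\<close> is a logarithm of
    coordinate \<open>i\<close> along the loop.\<close>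
  have end_turn: "turn t = - real c * (Im (m (2 * pi)) - Im (m 0))"
    if t: "t \<in> {0..1}" and c: "(\<lambda>x. F (x, t)) ` ?L a = ?L c" and m: "continuous_on {0..2 * pi} m"
      "\<And>x. x \<in> {0..2 * pi} \<Longrightarrow> h t (\<theta> x) $ i = exp (m x)" for t c m
  proof -
    have r: "range (h t) \<subseteq> ?L c" using rh[of t] c by simp
    have "\<forall>s. \<exists>r. frame_det (h t) k s =
        (\<Prod>j\<in>UNIV. if j = k then 1 else \<i>) * of_real r * (\<Prod>l\<in>UNIV. h t s $ l)"
      by (intro allI frame_det_weight_torus[OF _ h[OF t] r]) simp
    from choice[OF this] obtain R where R: "\<And>s. frame_det (h t) k s =
        (\<Prod>j\<in>UNIV. if j = k then 1 else \<i>) * of_real (R s) * (\<Prod>l\<in>UNIV. h t s $ l)"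
      by blast
    let ?w = "spiked_weight i c"
    have "Im (l (2 * pi, t)) - Im (l (0, t)) = - real c * (Im (m (2 * pi)) - Im (m 0))"
    proof (rule phase_increment[where S="{0..2 * pi}" and l="\<lambda>x. l (x, t)" and r="\<lambda>x. R (\<theta> x)" and
          P="\<lambda>x. \<Prod>l\<in>UNIV. h t (\<theta> x) $ l" and R="\<Prod>j\<in>UNIV. weight_radius ?w j ^ ?w j"])
      show "continuous_on {0..2 * pi} (\<lambda>x. l (x, t))"
        using t by (intro continuous_intros continuous_on_compose2[OF l(1)]) auto
      show "exp (l (x, t)) = (\<Prod>j\<in>UNIV. if j = k then 1 else \<i>) * of_real (R (\<theta> x)) * (\<Prod>l\<in>UNIV. h t (\<theta> x) $ l)"
        if "x \<in> {0..2 * pi}" for x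
        using l(2)[of "(x, t)"] t that by (simp add: D_def R)
      show "(\<Prod>l\<in>UNIV. h t (\<theta> x) $ l) * exp (m x) ^ c = of_real (\<Prod>j\<in>UNIV. weight_radius ?w j ^ ?w j)"
        if x: "x \<in> {0..2 * pi}" for x
      proof -
        have "h t (\<theta> x) \<in> ?L c" using r by blast
        then show ?thesis
          unfolding weight_torus_def using prod_spiked_weight[of "h t (\<theta> x)" i c] by (simp add: m(2)[OF x])
      qed
      show "(\<Prod>j\<in>UNIV. weight_radius ?w j ^ ?w j) > 0"
        by (intro prod_pos ballI zero_less_power weight_radius_pos) simp
    qed (use m in auto)
    then show ?thesis by (simp add: turn_def)
  qed
  have "turn 0 = - real a * (2 * pi)"
  proof -
    let ?r = "weight_radius (spiked_weight i a) i"
    have r: "?r > 0" by (rule weight_radius_pos) simp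
    \<comment> \<open>At time 0 the isotopy is the inclusion, so coordinate \<open>i\<close> is the
      radius times exp (\<i> * x), with this explicit logarithm.\<close>
    have "turn 0 = - real a * (Im (of_real (ln ?r) + \<i> * of_real (2 * pi)) - Im (of_real (ln ?r) + \<i> * of_real 0))"
    proof (rule end_turn)
      show "(\<lambda>x. F (x, 0)) ` ?L a = ?L a" using F0 by simp
      show "h 0 (\<theta> x) $ i = exp (of_real (ln ?r) + \<i> * of_real x)" for x
        using F0[OF \<Phi>] r ik
        by (simp add: h_def H_def torus_param_nth \<theta>_def exp_add exp_of_real)
    qed (auto intro!: continuous_intros)
    then show ?thesis by simp
  qed
  \<comment> \<open>\<open>N\<close> is the winding number of coordinate \<open>i\<close> along the
    image of the loop at time 1.\<close>
  moreover obtain N :: int where "turn 1 = - real b * (2 * pi * of_int N)"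
  proof -
    have cont: "continuous_on {0..2 * pi} (\<lambda>x. h 1 (\<theta> x) $ i)"
      using Cinf_on_imp_continuous_on[OF h[of 1]]
      by (intro continuous_intros continuous_on_compose2[OF _ cont_\<theta>]) auto
    have nz: "h 1 (\<theta> x) $ i \<noteq> 0" for x
      using weight_torus_component_nonzero[of "spiked_weight i b" "h 1 (\<theta> x)" i] rh[of 1] F1 by auto
    obtain m where m: "continuous_on {0..2 * pi} m"
      "\<And>x. x \<in> {0..2 * pi} \<Longrightarrow> h 1 (\<theta> x) $ i = exp (m x)"
      using continuous_logarithm_on_contractible[OF cont convex_imp_contractible[OF convex_real_interval(5)] nz]
      by blast
    have "exp (m (2 * pi)) = exp (m 0)" using m(2)[of 0] m(2)[of "2 * pi"] h_per[of 1] by (simp add: \<theta>_per)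
    then obtain N :: int where "m (2 * pi) = m 0 + of_real (of_int (2 * N) * pi) * \<i>"
      unfolding exp_eq by blast
    then have "Im (m (2 * pi)) - Im (m 0) = 2 * pi * of_int N" by simp
    then have "turn 1 = - real b * (2 * pi * of_int N)" using end_turn[OF _ F1 m] by simp
    then show ?thesis by (rule that)
  qed
  ultimately have "real a * (2 * pi) = (real b * of_int N) * (2 * pi)" using turn by (simp add: mult_ac)
  then have "real a = real b * of_int N" by simp
  then have "int a = int b * N" by (metis of_int_eq_iff of_int_mult of_int_of_nat_eq)
  then show "b dvd a" by (metis dvd_triv_left int_dvd_int_iff)
qed

text \<open>The squared modulus of coordinate \<open>k\<close> is 1 / (n + a), with n the number of
  coordinates, and determines \<open>a\<close>; this keeps the family of tori infinite.\<close>

lemma weight_torus_spiked_inject: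
  fixes i k :: "'n::finite"
  assumes ik: "i \<noteq> k" and eq: "weight_torus (spiked_weight i a) = weight_torus (spiked_weight i b)"
  shows "a = b"
proof -
  have sum: "(\<Sum>l\<in>UNIV. spiked_weight i c l) = CARD('n) + c" for c
    by (simp add: spiked_weight_def sum.remove[of UNIV i] card_Diff_singleton)
  let ?z = "torus_param (spiked_weight i a) k 0"
  have z: "?z \<in> weight_torus (spiked_weight i a)"
    by (rule torus_param_in_weight_torus) (use ik in auto)
  have "cmod (?z $ k) = weight_radius (spiked_weight i a) k"
    using z by (simp add: weight_torus_def)
  moreover have "cmod (?z $ k) = weight_radius (spiked_weight i b) k"
    using z unfolding eq by (simp add: weight_torus_def)
  ultimately have "weight_radius (spiked_weight i a) k = weight_radius (spiked_weight i b) k" by simp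
  moreover have "(weight_radius (spiked_weight i c) k)\<^sup>2 = 1 / real (CARD('n) + c)" for c
    unfolding weight_radius_power2 sum using ik by simp
  ultimately have "1 / real (CARD('n) + a) = 1 / real (CARD('n) + b)" by metis
  then show ?thesis by (simp del: of_nat_add)
qed

theorem corollary1p2:
  assumes "CARD('n::finite) > 1"
    and "CARD('m::finite) = CARD('n) - 1"
  shows "\<exists>\<L> :: (complex ^ 'n) set set.
           infinite \<L> \<and>
           (\<forall>L\<in>\<L>. legendrian L \<and> diffeomorphic (torus :: (complex ^ 'm) set) L) \<and>
           pairwise (\<lambda>L L'. \<not> legendrian_isotopic L L') \<L>"
proof -
  \<comment> \<open>Two roles need two indices: \<open>i\<close> carries the large weight, and
    \<open>k\<close>, of weight 1, is the coordinate solved for.\<close>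
  obtain i k :: 'n where ik: "i \<noteq> k"
    using assms(1) by (metis (full_types) card_le_Suc0_iff_eq finite not_less One_nat_def)
  let ?L = "\<lambda>a. weight_torus (spiked_weight i a)"
  have "inj_on ?L {p. prime p}"
    using weight_torus_spiked_inject[OF ik] by (intro inj_onI)
  then have "infinite (?L ` {p. prime p})"
    using primes_infinite by (simp add: finite_image_iff)
  moreover have "legendrian (?L a)" for a by (rule legendrian_weight_torus) simp
  moreover have "diffeomorphic (torus :: (complex ^ 'm) set) (?L a)" for a
    by (rule diffeomorphic_torus_weight_torus[OF _ _ assms(2), of _ k]) (use ik in auto)
  moreover have "pairwise (\<lambda>L L'. \<not> legendrian_isotopic L L') (?L ` {p. prime p})"
  proof (rule pairwise_imageI)
    fix p q :: nat assume "p \<in> {p. prime p}" "q \<in> {p. prime p}" "p \<noteq> q"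
    \<comment> \<open>An isotopy from \<open>p\<close> to \<open>q\<close> makes the prime
      \<open>q\<close> divide the prime \<open>p\<close>; every ordered pair is treated directly,
      without appeal to symmetry of the isotopy relation.\<close>
    then show "\<not> legendrian_isotopic (?L p) (?L q)"
      using legendrian_isotopic_imp_dvd[OF ik, of p q] primes_dvd_imp_eq[of q p] by auto
  qed
  ultimately show ?thesis by blast
qed

end
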